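(* Let $(\mathcal{A},\pi_0)$ be a Poisson algebra over $\mathbf{F}$. Let $(\vartheta_k\in\mathfrak{X}^2(\mathcal{A}))_{k\in\mathcal{K}}$ be a set of Poisson $2$-cocycles whose cohomology classes form an $\mathbf{F}$-basis of $H^2(\mathcal{A},\pi_0)$. Let $\mathcal{S}$ be the set of all families $\mathbf{a}=(a_n^k\in\mathbf{F})_{k\in\mathcal{K},\,n\in\mathbf{N}^*}$ such that, for every $n_0\in\mathbf{N}^*$, the family $(a_{n_0}^k)_{k\in\mathcal{K}}$ has finite support. Suppose that to each $\mathbf{a}=(a_n^k)\in\mathcal{S}$ is associated a sequence $(\Psi_n^{\mathbf{a}}\in\mathfrak{X}^2(\mathcal{A}))_{n\in\mathbf{N}^*}$ of skew-symmetric biderivations of $\mathcal{A}$ such that: (i) $\Psi_1^{\mathbf{a}}=0$; (ii) for all $n\in\mathbf{N}^*$, $\Psi_n^{\mathbf{a}}$ depends only on the $a_m^k$ with $k\in\mathcal{K}$ and $1\le m\le n-1$ (i.e. $\Psi_n^{\mathbf{a}}=\Psi_n^{\mathbf{b}}$ whenever $a_m^k=b_m^k$ for all $k\in\mathcal{K}$ and $1\le m\le n-1$); (iii) the skew-symmetric biderivation of $\mathcal{A}[[\nu]]$ defined by $$\pi_*^{\mathbf{a}}:=\pi_0+\sum_{n\in\mathbf{N}^*}\Big(\Psi_n^{\mathbf{a}}+\sum_{k\in\mathcal{K}}a_n^k\,\vartheta_k\Big)\nu^n$$ is a formal deformation of $\pi_0$. Then: (a) for every formal deformation $\pi_*$ of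 $\pi_0$, there exists $\mathbf{a}\in\mathcal{S}$ such that $\pi_*$ is equivalent to $\pi_*^{\mathbf{a}}$; (b) if, in addition, $H^1(\mathcal{A},\pi_0)=\{0\}$, then the element $\mathbf{a}\in\mathcal{S}$ in (a) is unique.
   Context: $\mathbf{F}$ is a field of characteristic zero and $\mathbf{N}^*=\{1,2,3,\dots\}$. For an associative commutative $\mathbf{F}$-algebra $\mathcal{A}$, $\mathfrak{X}^0(\mathcal{A})=\mathcal{A}$ and, for $k\ge1$, $\mathfrak{X}^k(\mathcal{A})$ is the space of skew-symmetric $\mathbf{F}$-$k$-linear maps $\mathcal{A}^k\to\mathcal{A}$ that are derivations in each argument. A Poisson structure on $\mathcal{A}$ is an element $\pi_0\in\mathfrak{X}^2(\mathcal{A})$ satisfying the Jacobi identity; $(\mathcal{A},\pi_0)$ is then a Poisson algebra. Schouten bracket: for $P\in\mathfrak{X}^p(\mathcal{A})$, $Q\in\mathfrak{X}^q(\mathcal{A})$, $[P,Q]_S\in\mathfrak{X}^{p+q-1}(\mathcal{A})$ is $$[P,Q]_S[F_1,\dots,F_{p+q-1}]=\sum_{\sigma\in S_{q,p-1}}\epsilon(\sigma)P\big[Q[F_{\sigma(1)},\dots,F_{\sigma(q)}],F_{\sigma(q+1)},\dots,F_{\sigma(q+p-1)}\big]-(-1)^{(p-1)(q-1)}\sum_{\sigma\in S_{p,q-1}}\epsilon(\sigma)Q\big[P[F_{\sigma(1)},\dots,F_{\sigma(p)}],F_{\sigma(p+1)},\dots,F_{\sigma(p+q-1)}\big],$$ where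 $S_{k,\ell}$ is the set of permutations $\sigma$ of $\{1,\dots,k+\ell\}$ with $\sigma(1)<\dots<\sigma(k)$ and $\sigma(k+1)<\dots<\sigma(k+\ell)$ (a sum involving a negative index is empty), and $\epsilon(\sigma)$ is the signature. Poisson cohomology: $\delta^k_{\pi_0}:\mathfrak{X}^k(\mathcal{A})\to\mathfrak{X}^{k+1}(\mathcal{A})$, $\delta^k_{\pi_0}(P)=-[P,\pi_0]_S$, satisfies $\delta^{k+1}_{\pi_0}\delta^k_{\pi_0}=0$; elements of $\ker\delta^k_{\pi_0}$ are the (Poisson) $k$-cocycles, elements of $\operatorname{Im}\delta^{k-1}_{\pi_0}$ are the $k$-coboundaries, and $H^k(\mathcal{A},\pi_0)=\ker\delta^k_{\pi_0}/\operatorname{Im}\delta^{k-1}_{\pi_0}$ for $k\ge1$. $\mathcal{A}[[\nu]]$ is the $\mathbf{F}[[\nu]]$-algebra of formal power series with the product extended from $\mathcal{A}$; maps on $\mathcal{A}$ are extended $\mathbf{F}[[\nu]]$-multilinearly. A formal deformation of $\pi_0$ is a map $\pi_*=\pi_0+\pi_1\nu+\pi_2\nu^2+\cdots:\mathcal{A}[[\nu]]\times\mathcal{A}[[\nu]]\to\mathcal{A}[[\nu]]$, with all $\pi_i\in\mathfrak{X}^2(\mathcal{A})$, which satisfies the Jacobi identity (i.e. makes $\mathcal{A}[[\nu]]$ a Poisson algebra over $\mathbf{F}[[\nu]]$). Two formal deformations $\pi_*,\pi'_*$ of $\pi_0$ are equivalent if there is an $\mathbf{F}[[\nu]]$-linear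 morphism of associative algebras $\Phi:\mathcal{A}[[\nu]]\to\mathcal{A}[[\nu]]$, equal to the identity modulo $\nu$, with $\Phi(\pi_*[F,G])=\pi'_*[\Phi(F),\Phi(G)]$ for all $F,G$. *)

theory Defs
  imports
    "HOL-Computational_Algebra.Formal_Power_Series"
    "HOL-Combinatorics.Permutations"
    "HOL-Algebra.Module"
begin

text \<open>An associative commutative algebra over a field of characteristic zero; a unit is not assumed.\<close>

locale comm_algebra = vector_space scale
  for scale :: "'f::field_char_0 \<Rightarrow> 'a::comm_ring \<Rightarrow> 'a" +
  assumes scale_mult_left: "scale c (x * y) = scale c x * y"

text \<open>A \<open>k\<close>-ary map is a function on argument lists that is \<open>0\<close> on lists of length other than
  \<open>k\<close>, so that equality of maps is equality of functions. A \<open>0\<close>-ary map is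
  identified with its value at \<open>[]\<close>, which makes \<open>multiderivations scale 0\<close> a copy of the
  algebra.\<close>

definition multiderivations ::
    "('f::field \<Rightarrow> 'a::comm_ring \<Rightarrow> 'a) \<Rightarrow> nat \<Rightarrow> ('a list \<Rightarrow> 'a) set" where
  "multiderivations scale k = {P.
     (\<forall>Fs. length Fs \<noteq> k \<longrightarrow> P Fs = 0) \<and>
     (\<forall>Fs i. length Fs = k \<and> i < k \<longrightarrow>
        Vector_Spaces.linear scale scale (\<lambda>x. P (Fs[i := x])) \<and>
        (\<forall>x y. P (Fs[i := x * y]) = x * P (Fs[i := y]) + y * P (Fs[i := x]))) \<and>
     (\<forall>Fs \<sigma>. length Fs = k \<and> \<sigma> permutes {..<k} \<longrightarrow>
        P (permute_list \<sigma> Fs) = scale (of_int (sign \<sigma>)) (P Fs))}"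

definition jacobi :: "('a::ab_group_add list \<Rightarrow> 'a) \<Rightarrow> bool" where
  "jacobi \<pi> \<longleftrightarrow> (\<forall>F G H. \<pi> [\<pi> [F, G], H] + \<pi> [\<pi> [G, H], F] + \<pi> [\<pi> [H, F], G] = 0)"

definition poisson_structure ::
    "('f::field \<Rightarrow> 'a::comm_ring \<Rightarrow> 'a) \<Rightarrow> ('a list \<Rightarrow> 'a) \<Rightarrow> bool" where
  "poisson_structure scale \<pi> \<longleftrightarrow> \<pi> \<in> multiderivations scale 2 \<and> jacobi \<pi>"

text \<open>Shuffles permute \<open>{0, \<dots>, k + l - 1}\<close>, matching list indices. The integer
  arguments may be \<open>-1\<close>, in which case there are no shuffles.\<close>

definition shuffle_perms :: "int \<Rightarrow> int \<Rightarrow> (nat \<Rightarrow> nat) set" where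
  "shuffle_perms k l = {\<sigma>. 0 \<le> k \<and> 0 \<le> l \<and> \<sigma> permutes {..<nat (k + l)} \<and>
     strict_mono_on {..<nat k} \<sigma> \<and> strict_mono_on {nat k..<nat (k + l)} \<sigma>}"

text \<open>The degrees \<open>p\<close> and \<open>q\<close> of \<open>P\<close> and \<open>Q\<close> are passed explicitly. The entry of
  \<open>permute_list \<sigma> Fs\<close> at position \<open>i\<close> is \<open>Fs ! \<sigma> i\<close>.\<close>

definition schouten :: "('f::field \<Rightarrow> 'a::comm_ring \<Rightarrow> 'a) \<Rightarrow> nat \<Rightarrow> nat \<Rightarrow>
    ('a list \<Rightarrow> 'a) \<Rightarrow> ('a list \<Rightarrow> 'a) \<Rightarrow> 'a list \<Rightarrow> 'a" where
  "schouten scale p q P Q Fs =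
     (if int (length Fs) = int p + int q - 1 then
        (\<Sum>\<sigma>\<in>shuffle_perms (int q) (int p - 1). scale (of_int (sign \<sigma>))
           (let Gs = permute_list \<sigma> Fs in P (Q (take q Gs) # drop q Gs)))
        - scale ((- 1) powi ((int p - 1) * (int q - 1)))
          (\<Sum>\<sigma>\<in>shuffle_perms (int p) (int q - 1). scale (of_int (sign \<sigma>))
             (let Gs = permute_list \<sigma> Fs in Q (P (take p Gs) # drop p Gs)))
      else 0)"

definition poisson_delta :: "('f::field \<Rightarrow> 'a::comm_ring \<Rightarrow> 'a) \<Rightarrow> ('a list \<Rightarrow> 'a) \<Rightarrow> nat \<Rightarrow>
    ('a list \<Rightarrow> 'a) \<Rightarrow> 'a list \<Rightarrow> 'a" where
  "poisson_delta scale \<pi>\<^sub>0 k P = (\<lambda>Fs. - schouten scale k 2 P \<pi>\<^sub>0 Fs)"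

definition poisson_cocycles :: "('f::field \<Rightarrow> 'a::comm_ring \<Rightarrow> 'a) \<Rightarrow> ('a list \<Rightarrow> 'a) \<Rightarrow> nat \<Rightarrow>
    ('a list \<Rightarrow> 'a) set" where
  "poisson_cocycles scale \<pi>\<^sub>0 k =
     {P \<in> multiderivations scale k. poisson_delta scale \<pi>\<^sub>0 k P = (\<lambda>_. 0)}"

text \<open>Only meaningful for \<open>k \<ge> 1\<close>.\<close>

definition poisson_coboundaries :: "('f::field \<Rightarrow> 'a::comm_ring \<Rightarrow> 'a) \<Rightarrow> ('a list \<Rightarrow> 'a) \<Rightarrow> nat \<Rightarrow>
    ('a list \<Rightarrow> 'a) set" where
  "poisson_coboundaries scale \<pi>\<^sub>0 k =
     poisson_delta scale \<pi>\<^sub>0 (k - 1) ` multiderivations scale (k - 1)"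

definition cohomology_class :: "('f::field \<Rightarrow> 'a::comm_ring \<Rightarrow> 'a) \<Rightarrow> ('a list \<Rightarrow> 'a) \<Rightarrow> nat \<Rightarrow>
    ('a list \<Rightarrow> 'a) \<Rightarrow> ('a list \<Rightarrow> 'a) set" where
  "cohomology_class scale \<pi>\<^sub>0 k P =
     {(\<lambda>Fs. P Fs + B Fs) | B. B \<in> poisson_coboundaries scale \<pi>\<^sub>0 k}"

text \<open>The quotient vector space of cocycles by coboundaries, as a set of cosets. The
  ring components of the record play no role. In the scalar multiplication a
  coboundary is added so that \<open>0\<close> times a coset is again a coset.\<close>

definition poisson_cohomology :: "('f::field \<Rightarrow> 'a::comm_ring \<Rightarrow> 'a) \<Rightarrow> ('a list \<Rightarrow> 'a) \<Rightarrow> nat \<Rightarrow>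
    ('f, ('a list \<Rightarrow> 'a) set) module" where
  "poisson_cohomology scale \<pi>\<^sub>0 k =
     \<lparr>carrier = cohomology_class scale \<pi>\<^sub>0 k ` poisson_cocycles scale \<pi>\<^sub>0 k,
      mult = undefined, one = undefined,
      zero = poisson_coboundaries scale \<pi>\<^sub>0 k,
      add = (\<lambda>C D. {(\<lambda>Fs. P Fs + Q Fs) | P Q. P \<in> C \<and> Q \<in> D}),
      smult = (\<lambda>c C. {(\<lambda>Fs. scale c (P Fs) + B Fs) | P B.
                        P \<in> C \<and> B \<in> poisson_coboundaries scale \<pi>\<^sub>0 k})\<rparr>"

definition basis_family :: "('f::field, 'v) module \<Rightarrow> 'k set \<Rightarrow> ('k \<Rightarrow> 'v) \<Rightarrow> bool" where
  "basis_family V K v \<longleftrightarrow>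
     (\<forall>k\<in>K. v k \<in> carrier V) \<and>
     (\<forall>A c. finite A \<and> A \<subseteq> K \<and> (\<Oplus>\<^bsub>V\<^esub>k\<in>A. c k \<odot>\<^bsub>V\<^esub> v k) = \<zero>\<^bsub>V\<^esub> \<longrightarrow> (\<forall>k\<in>A. c k = 0)) \<and>
     (\<forall>x\<in>carrier V. \<exists>A c. finite A \<and> A \<subseteq> K \<and> x = (\<Oplus>\<^bsub>V\<^esub>k\<in>A. c k \<odot>\<^bsub>V\<^esub> v k))"

definition fps_scale :: "('f::comm_ring_1 \<Rightarrow> 'a::comm_ring \<Rightarrow> 'a) \<Rightarrow> 'f fps \<Rightarrow> 'a fps \<Rightarrow> 'a fps" where
  "fps_scale scale c F = Abs_fps (\<lambda>n. \<Sum>i\<le>n. scale (fps_nth c i) (fps_nth F (n - i)))"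

text \<open>The (\<open>\<nu>\<close>-adically continuous) extension of a bilinear map to formal power series.\<close>

definition fps_bilinear_ext :: "('a::comm_ring list \<Rightarrow> 'a) \<Rightarrow> 'a fps list \<Rightarrow> 'a fps" where
  "fps_bilinear_ext P Fs = (if length Fs = 2
     then Abs_fps (\<lambda>n. \<Sum>j\<le>n. P [fps_nth (Fs ! 0) j, fps_nth (Fs ! 1) (n - j)])
     else 0)"

text \<open>The map \<open>\<Sum>\<^sub>i \<pi>\<^sub>i \<nu>\<^sup>i\<close>, given coefficientwise.\<close>

definition nu_series :: "(nat \<Rightarrow> 'a::comm_ring list \<Rightarrow> 'a) \<Rightarrow> 'a fps list \<Rightarrow> 'a fps" where
  "nu_series \<pi>s Fs = Abs_fps (\<lambda>n. \<Sum>i\<le>n. fps_nth (fps_bilinear_ext (\<pi>s i) Fs) (n - i))"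

definition formal_deformation :: "('f::field \<Rightarrow> 'a::comm_ring \<Rightarrow> 'a) \<Rightarrow> ('a list \<Rightarrow> 'a) \<Rightarrow>
    ('a fps list \<Rightarrow> 'a fps) \<Rightarrow> bool" where
  "formal_deformation scale \<pi>\<^sub>0 \<pi> \<longleftrightarrow>
     (\<exists>\<pi>s. \<pi>s 0 = \<pi>\<^sub>0 \<and> (\<forall>i. \<pi>s i \<in> multiderivations scale 2) \<and> \<pi> = nu_series \<pi>s) \<and> jacobi \<pi>"

definition equivalent_deformations :: "('f::field \<Rightarrow> 'a::comm_ring \<Rightarrow> 'a) \<Rightarrow>
    ('a fps list \<Rightarrow> 'a fps) \<Rightarrow> ('a fps list \<Rightarrow> 'a fps) \<Rightarrow> bool" where
  "equivalent_deformations scale \<pi> \<pi>' \<longleftrightarrow>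
     (\<exists>\<Phi>. Modules.module_hom (fps_scale scale) (fps_scale scale) \<Phi> \<and>
          (\<forall>F G. \<Phi> (F * G) = \<Phi> F * \<Phi> G) \<and>
          (\<forall>F. fps_nth (\<Phi> F) 0 = fps_nth F 0) \<and>
          (\<forall>F G. \<Phi> (\<pi> [F, G]) = \<pi>' [\<Phi> F, \<Phi> G]))"

text \<open>The families \<open>(a n k)\<close> with \<open>n \<ge> 1\<close> and \<open>k \<in> K\<close>, finitely supported in \<open>k\<close>. They are
  extended by \<open>0\<close> to other indices, so that equality of families is equality of functions.\<close>

definition coefficient_families :: "'k set \<Rightarrow> (nat \<Rightarrow> 'k \<Rightarrow> 'f::field) set" where
  "coefficient_families K =
     {a. (\<forall>n k. n = 0 \<or> k \<notin> K \<longrightarrow> a n k = 0) \<and> (\<forall>n\<ge>1. finite {k \<in> K. a n k \<noteq> 0})}"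

definition deformation_family :: "('f::field \<Rightarrow> 'a::comm_ring \<Rightarrow> 'a) \<Rightarrow> ('a list \<Rightarrow> 'a) \<Rightarrow>
    'k set \<Rightarrow> ('k \<Rightarrow> 'a list \<Rightarrow> 'a) \<Rightarrow> (nat \<Rightarrow> 'a list \<Rightarrow> 'a) \<Rightarrow> (nat \<Rightarrow> 'k \<Rightarrow> 'f) \<Rightarrow>
    'a fps list \<Rightarrow> 'a fps" where
  "deformation_family scale \<pi>\<^sub>0 K \<theta> \<psi> a = nu_series (\<lambda>n. if n = 0 then \<pi>\<^sub>0 else
     (\<lambda>Fs. \<psi> n Fs + (\<Sum>k\<in>{k \<in> K. a n k \<noteq> 0}. scale (a n k) (\<theta> k Fs))))"

end

theory Submission
  imports Defs
begin

text \<open>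
  A morphism \<open>\<Phi>\<close> to a deformation of the family is built order by order. If \<open>\<Phi>\<close> intertwines the two
  brackets below order \<open>n\<close>, the failure at order \<open>n\<close> is a 2-cocycle of \<open>\<pi>\<^sub>0\<close>, hence a combination of the
  \<open>\<theta> k\<close> plus the coboundary of a derivation \<open>V\<close>. The combination is absorbed by changing the
  coefficients \<open>a n\<close>, the coboundary by replacing \<open>\<Phi>\<close> with \<open>exp (\<nu>\<^sup>n V) \<circ> \<Phi>\<close>; the \<open>\<nu>\<close>-adic limit
  is the equivalence. No inverse of \<open>\<Phi>\<close> is ever needed.

  For uniqueness, let \<open>\<Phi>\<close> and \<open>\<Omega>\<close> intertwine the given bracket with the deformations of parameters \<open>a\<close>
  and \<open>b\<close>, and let them agree below order \<open>n\<close>. Their difference at order \<open>n\<close> is a derivation with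
  coboundary \<open>- (\<Sum>k. (a n k - b n k) \<theta> k)\<close>, so \<open>a n = b n\<close> and the derivation is a 1-cocycle. As the
  first cohomology vanishes it is \<open>- \<pi>\<^sub>0[h, \<cdot>]\<close>, and composing \<open>\<Phi>\<close> with the exponential of the Hamiltonian
  derivation \<open>\<nu>\<^sup>n \<pi>[h, \<cdot>]\<close>, where \<open>\<pi>\<close> is the deformation of parameter \<open>a\<close>, makes \<open>\<Phi>\<close> and \<open>\<Omega>\<close> agree
  at order \<open>n\<close> too.
\<close>

section \<open>Linear maps of formal power series\<close>

context comm_algebra
begin

abbreviation fscale :: "'f fps \<Rightarrow> 'a fps \<Rightarrow> 'a fps"
  where "fscale \<equiv> fps_scale scale"

abbreviation fps_linear :: "('a fps \<Rightarrow> 'a fps) \<Rightarrow> bool"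
  where "fps_linear \<equiv> Modules.module_hom fscale fscale"

definition fps_bilinear :: "('a fps \<Rightarrow> 'a fps \<Rightarrow> 'a fps) \<Rightarrow> bool"
  where "fps_bilinear B \<longleftrightarrow> (\<forall>G. fps_linear (\<lambda>F. B F G)) \<and> (\<forall>F. fps_linear (B F))"

lemma scale_mult_right: "scale c (x * y) = x * scale c y"
  by (metis mult.commute scale_mult_left)

lemma fscale_nth: "fps_nth (fscale c F) n = (\<Sum>i\<le>n. scale (fps_nth c i) (fps_nth F (n - i)))"
  by (simp add: fps_scale_def)

lemma module_fscale: "Modules.module fscale"
proof
  fix c d :: "'f fps" and F G :: "'a fps"
  show "fscale c (F + G) = fscale c F + fscale c G"
    by (rule fps_ext) (simp add: fscale_nth scale_right_distrib sum.distrib)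
  show "fscale (c + d) F = fscale c F + fscale d F"
    by (rule fps_ext) (simp add: fscale_nth scale_left_distrib sum.distrib)
  show "fscale 1 F = F"
  proof (rule fps_ext)
    fix n
    have "fps_nth (fscale 1 F) n = (\<Sum>i\<le>n. if i = 0 then fps_nth F n else 0)"
      unfolding fscale_nth by (intro sum.cong) auto
    then show "fps_nth (fscale 1 F) n = fps_nth F n" by simp
  qed
  show "fscale c (fscale d F) = fscale (c * d) F"
  proof (rule fps_ext)
    fix n
    have "fps_nth (fscale (c * d) F) n =
        (\<Sum>j=0..n. \<Sum>i=0..j. scale (fps_nth c i * fps_nth d (j - i)) (fps_nth F (n - j)))"
      by (simp add: fscale_nth fps_mult_nth scale_sum_left atMost_atLeast0)
    \<comment> \<open>The reindexing behind associativity of the Cauchy product holds for any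
      summand in three indices, so it also covers scalars acting on the algebra.\<close>
    also have "\<dots> = (\<Sum>j=0..n. \<Sum>i=0..n - j. scale (fps_nth c j * fps_nth d i) (fps_nth F (n - j - i)))"
      by (rule fps_mult_assoc_lemma)
    also have "\<dots> = fps_nth (fscale c (fscale d F)) n"
      by (simp add: fscale_nth scale_sum_right atMost_atLeast0)
    finally show "fps_nth (fscale c (fscale d F)) n = fps_nth (fscale (c * d) F) n" by simp
  qed
qed

sublocale fps: Modules.module fscale
  by (rule module_fscale)

lemma fscale_const_nth [simp]: "fps_nth (fscale (fps_const c) F) n = scale c (fps_nth F n)"
proof -
  have "fps_nth (fscale (fps_const c) F) n = (\<Sum>i\<le>n. if i = 0 then scale c (fps_nth F n) else 0)"
    unfolding fscale_nth by (intro sum.cong) auto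
  then show ?thesis by simp
qed

lemma fscale_X_power_nth [simp]:
  "fps_nth (fscale (fps_X ^ k) F) n = (if n < k then 0 else fps_nth F (n - k))"
proof -
  have "fps_nth (fscale (fps_X ^ k) F) n = (\<Sum>i\<le>n. if i = k then fps_nth F (n - k) else 0)"
    unfolding fscale_nth by (intro sum.cong) (auto simp: fps_X_power_nth)
  then show ?thesis by simp
qed

lemma fscale_X_nth [simp]:
  "fps_nth (fscale fps_X F) n = (if n = 0 then 0 else fps_nth F (n - 1))"
  using fscale_X_power_nth [of 1] by simp

lemma fscale_mult_left: "fscale c (F * G) = fscale c F * G"
proof (rule fps_ext)
  fix n
  have "fps_nth (fscale c F * G) n =
      (\<Sum>j=0..n. \<Sum>i=0..j. scale (fps_nth c i) (fps_nth F (j - i) * fps_nth G (n - j)))"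
    by (simp add: fscale_nth fps_mult_nth sum_distrib_right scale_mult_left atMost_atLeast0)
  also have "\<dots> = (\<Sum>j=0..n. \<Sum>i=0..n - j. scale (fps_nth c j) (fps_nth F i * fps_nth G (n - j - i)))"
    by (rule fps_mult_assoc_lemma)
  also have "\<dots> = fps_nth (fscale c (F * G)) n"
    by (simp add: fscale_nth fps_mult_nth scale_sum_right atMost_atLeast0)
  finally show "fps_nth (fscale c (F * G)) n = fps_nth (fscale c F * G) n" by simp
qed

lemma fps_eq_const_plus_X: "F = fps_const (fps_nth F 0) + fscale fps_X (fps_shift 1 F)"
  by (rule fps_ext) auto

lemma fps_eq_X_power_shift:
  assumes "\<forall>i<k. fps_nth F i = 0"
  shows "F = fscale (fps_X ^ k) (fps_shift k F)"
  using assms by (intro fps_ext) auto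

lemma fps_scalar_eq_const_plus_X:
  "c = fps_const (fps_nth c 0) + fps_X * fps_shift 1 (c :: 'f fps)"
  by (rule fps_ext) auto

lemma fps_linearD:
  assumes "fps_linear L"
  shows "L (F + G) = L F + L G" "L (F - G) = L F - L G" "L 0 = 0" "L (- F) = - L F"
    "L (fscale c F) = fscale c (L F)" "L (sum f A) = (\<Sum>x\<in>A. L (f x))"
  by (rule module_hom.add [OF assms] module_hom.diff [OF assms] module_hom.zero [OF assms]
      module_hom.neg [OF assms] module_hom.scale [OF assms] module_hom.sum [OF assms])+

lemma fps_linear_iff:
  "fps_linear L \<longleftrightarrow> (\<forall>F G. L (F + G) = L F + L G) \<and> (\<forall>c F. L (fscale c F) = fscale c (L F))"
  by (simp add: module_hom_iff module_fscale)

text \<open>Writing \<open>c\<close> as its constant term plus \<open>fps_X\<close> times a shifted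
  series reduces coefficient \<open>Suc n\<close> of \<open>L (fscale c F)\<close> to coefficient
  \<open>n\<close> for the shift, so continuity of \<open>L\<close> never enters.\<close>

lemma fps_linearI:
  assumes add: "\<And>F G. L (F + G) = L F + L G"
    and const: "\<And>c F. L (fscale (fps_const c) F) = fscale (fps_const c) (L F)"
    and X: "\<And>F. L (fscale fps_X F) = fscale fps_X (L F)"
  shows "fps_linear L"
proof -
  have split: "L (fscale c F) = fscale (fps_const (fps_nth c 0)) (L F)
      + fscale fps_X (L (fscale (fps_shift 1 c) F))" for c F
  proof -
    have "L (fscale c F) = L (fscale (fps_const (fps_nth c 0)) F + fscale fps_X (fscale (fps_shift 1 c) F))"
      by (subst fps_scalar_eq_const_plus_X [of c]) (simp add: fps.scale_left_distrib)
    then show ?thesis by (simp add: add const X del: fps.scale_scale)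
  qed
  have "fps_nth (L (fscale c F)) n = fps_nth (fscale c (L F)) n" for c F n
  proof (induction n arbitrary: c)
    case 0
    show ?case by (subst split) (simp add: fscale_nth)
  next
    case (Suc n)
    have "fscale c (L F) = fscale (fps_const (fps_nth c 0)) (L F)
        + fscale fps_X (fscale (fps_shift 1 c) (L F))"
      by (subst fps_scalar_eq_const_plus_X [of c]) (simp add: fps.scale_left_distrib)
    then show ?case by (subst split) (simp add: Suc del: fps.scale_scale)
  qed
  then show ?thesis by (auto simp: fps_linear_iff add intro: fps_ext)
qed

lemma fps_linear_id: "fps_linear (\<lambda>F. F)"
  by (simp add: fps_linear_iff)

lemma fps_linear_comp: "fps_linear L \<Longrightarrow> fps_linear M \<Longrightarrow> fps_linear (\<lambda>F. L (M F))"
  by (simp add: fps_linear_iff)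

lemma fps_linear_add: "fps_linear L \<Longrightarrow> fps_linear M \<Longrightarrow> fps_linear (\<lambda>F. L F + M F)"
  by (simp add: fps_linear_iff algebra_simps)

lemma fps_linear_diff: "fps_linear L \<Longrightarrow> fps_linear M \<Longrightarrow> fps_linear (\<lambda>F. L F - M F)"
  by (simp add: fps_linear_iff algebra_simps)

lemma fps_linear_fscale: "fps_linear L \<Longrightarrow> fps_linear (\<lambda>F. fscale c (L F))"
  by (simp add: fps_linear_iff fps.scale_right_distrib mult.commute)

text \<open>\<open>F\<close> is \<nu>^k times a series and \<open>L\<close> commutes with \<nu>^k:
  linearity over the scalar series already gives \<nu>-adic continuity.\<close>

lemma fps_linear_nth_eq_0:
  assumes "fps_linear L" "\<forall>i<k. fps_nth F i = 0" "i < k"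
  shows "fps_nth (L F) i = 0"
  using assms by (subst fps_eq_X_power_shift [OF assms(2)]) (simp add: fps_linearD)

lemma fps_linear_nth_cong:
  assumes "fps_linear L" "\<forall>i<k. fps_nth F i = fps_nth G i" "i < k"
  shows "fps_nth (L F) i = fps_nth (L G) i"
  using fps_linear_nth_eq_0 [OF assms(1), of k "F - G" i] assms by (simp add: fps_linearD)

lemma fps_linear_nth_0: "fps_linear L \<Longrightarrow> fps_nth (L F) 0 = fps_nth (L (fps_const (fps_nth F 0))) 0"
  by (rule fps_linear_nth_cong [where k = 1]) auto

text \<open>Once \<nu>^k is pulled out, coefficient 0 of the image sees only the constant term of
  what remains.\<close>

lemma fps_linear_nth_lead:
  assumes "fps_linear L" "\<forall>i<k. fps_nth F i = 0"
  shows "fps_nth (L F) k = fps_nth (L (fps_const (fps_nth F k))) 0"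
proof -
  have "fps_nth (L F) k = fps_nth (L (fps_shift k F)) 0"
    using assms(1) by (subst fps_eq_X_power_shift [OF assms(2)]) (simp add: fps_linearD)
  also have "\<dots> = fps_nth (L (fps_const (fps_nth F k))) 0"
    using fps_linear_nth_0 [OF assms(1), of "fps_shift k F"] by simp
  finally show ?thesis .
qed

text \<open>Peeling off the constant term leaves a multiple of \<nu>, whose image is shifted by one
  order; induction on the order reduces all series to constants.\<close>

lemma fps_linear_const_nth_eq_0:
  assumes "fps_linear L" "\<And>f i. i < n \<Longrightarrow> fps_nth (L (fps_const f)) i = 0"
  shows "i < n \<Longrightarrow> fps_nth (L F) i = 0"
proof (induction i arbitrary: F)
  case 0
  then show ?case using fps_linear_nth_0 [OF assms(1)] assms(2) by simp
next
  case (Suc i)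
  then show ?case
    by (subst fps_eq_const_plus_X) (simp add: fps_linearD [OF assms(1)] assms(2))
qed

text \<open>Counterpart of \<open>fps_linear_nth_lead\<close> with the vanishing in the map instead
  of the argument: what \<open>F\<close> has beyond its constant term contributes only from order
  \<open>n + 1\<close> on.\<close>

lemma fps_linear_nth_const:
  assumes "fps_linear L" "\<And>F i. i < n \<Longrightarrow> fps_nth (L F) i = 0"
  shows "fps_nth (L F) n = fps_nth (L (fps_const (fps_nth F 0))) n"
proof -
  have "fps_nth (L F) n = fps_nth (L (fps_const (fps_nth F 0))) n
      + fps_nth (fscale fps_X (L (fps_shift 1 F))) n"
    by (subst fps_eq_const_plus_X) (simp only: fps_linearD [OF assms(1)] fps_add_nth)
  then show ?thesis using assms(2) [of "n - 1"] by (cases n) auto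
qed

lemma fps_linear_eqI:
  assumes "fps_linear L" "fps_linear M" "\<And>f. L (fps_const f) = M (fps_const f)"
  shows "L F = M F"
proof (rule fps_ext)
  fix n
  show "fps_nth (L F) n = fps_nth (M F) n"
    using fps_linear_const_nth_eq_0 [OF fps_linear_diff [OF assms(1,2)], of "Suc n" n F] assms(3)
    by simp
qed

section \<open>Bilinear maps over the scalar series\<close>

lemma fps_bilinearD:
  assumes "fps_bilinear B"
  shows "fps_linear (\<lambda>F. B F G)" "fps_linear (B F)"
  using assms by (auto simp: fps_bilinear_def)

lemmas fps_bilinear_left = fps_linearD [OF fps_bilinearD(1)]
lemmas fps_bilinear_right = fps_linearD [OF fps_bilinearD(2)]

lemma fps_bilinear_diff:
  "fps_bilinear B \<Longrightarrow> fps_bilinear C \<Longrightarrow> fps_bilinear (\<lambda>F G. B F G - C F G)"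
  by (simp add: fps_bilinear_def fps_linear_diff)

lemma fps_bilinear_times: "fps_bilinear (*)"
proof -
  have "fscale c (F * G) = F * fscale c G" for c F G
    by (metis fscale_mult_left mult.commute)
  then show ?thesis
    by (simp add: fps_bilinear_def fps_linear_iff fscale_mult_left algebra_simps)
qed

lemma fps_bilinear_compose:
  assumes "fps_bilinear B" "fps_linear L" "fps_linear M"
  shows "fps_bilinear (\<lambda>F G. B (L F) (M G))"
  using assms fps_linear_comp [OF fps_bilinearD(1) [OF assms(1)] assms(2)]
    fps_linear_comp [OF fps_bilinearD(2) [OF assms(1)] assms(3)]
  by (simp add: fps_bilinear_def)

lemma fps_bilinear_compose_left:
  assumes "fps_bilinear B" "fps_linear L"
  shows "fps_bilinear (\<lambda>F G. L (B F G))"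
  using assms fps_linear_comp [OF assms(2)] by (simp add: fps_bilinear_def)

text \<open>A factor \<nu>^k comes out of the first slot; the second slot then supplies the
  remaining \<open>l\<close> orders.\<close>

lemma fps_bilinear_nth_eq_0:
  assumes "fps_bilinear B" "\<forall>i<k. fps_nth F i = 0" "\<forall>i<l. fps_nth G i = 0" "i < k + l"
  shows "fps_nth (B F G) i = 0"
proof -
  have "B F G = fscale (fps_X ^ k) (B (fps_shift k F) G)"
    by (subst fps_eq_X_power_shift [OF assms(2)]) (rule fps_bilinear_left [OF assms(1)])
  moreover have "fps_nth (B (fps_shift k F) G) (i - k) = 0" if "\<not> i < k"
    by (rule fps_linear_nth_eq_0 [OF fps_bilinearD(2) [OF assms(1)] assms(3)]) (use assms(4) that in auto)
  ultimately show ?thesis by auto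
qed

lemma fps_bilinear_nth_cong:
  assumes "fps_bilinear B" "\<forall>i<k. fps_nth F i = fps_nth F' i" "\<forall>i<k. fps_nth G i = fps_nth G' i" "i < k"
  shows "fps_nth (B F G) i = fps_nth (B F' G') i"
  using fps_linear_nth_cong [OF fps_bilinearD(1) [OF assms(1)] assms(2,4)]
    fps_linear_nth_cong [OF fps_bilinearD(2) [OF assms(1)] assms(3,4)] by simp

lemma fps_bilinear_nth_lead_left:
  assumes "fps_bilinear B" "\<forall>i<k. fps_nth F i = 0"
  shows "fps_nth (B F G) k = fps_nth (B (fps_const (fps_nth F k)) (fps_const (fps_nth G 0))) 0"
  using fps_linear_nth_lead [OF fps_bilinearD(1) [OF assms(1)] assms(2)]
    fps_linear_nth_0 [OF fps_bilinearD(2) [OF assms(1)]] by simp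

lemma fps_bilinear_nth_lead_right:
  assumes "fps_bilinear B" "\<forall>i<k. fps_nth G i = 0"
  shows "fps_nth (B F G) k = fps_nth (B (fps_const (fps_nth F 0)) (fps_const (fps_nth G k))) 0"
  using fps_linear_nth_lead [OF fps_bilinearD(2) [OF assms(1)] assms(2)]
    fps_linear_nth_0 [OF fps_bilinearD(1) [OF assms(1)]] by simp

lemma fps_bilinear_const_nth_eq_0:
  assumes "fps_bilinear B" "\<And>f g i. i < n \<Longrightarrow> fps_nth (B (fps_const f) (fps_const g)) i = 0" "i < n"
  shows "fps_nth (B F G) i = 0"
  using assms(2) fps_linear_const_nth_eq_0 [OF fps_bilinearD(1) [OF assms(1)]]
    fps_linear_const_nth_eq_0 [OF fps_bilinearD(2) [OF assms(1)]] assms(3) by metis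

lemma fps_bilinear_nth_const:
  assumes "fps_bilinear B" "\<And>F G i. i < n \<Longrightarrow> fps_nth (B F G) i = 0"
  shows "fps_nth (B F G) n = fps_nth (B (fps_const (fps_nth F 0)) (fps_const (fps_nth G 0))) n"
  using fps_linear_nth_const [OF fps_bilinearD(1) [OF assms(1)] assms(2)]
    fps_linear_nth_const [OF fps_bilinearD(2) [OF assms(1)] assms(2)] by metis

end

section \<open>Exponentials of derivations\<close>

context comm_algebra
begin

text \<open>Dividing by \<open>fact j\<close> frees the Leibniz rule of binomial coefficients; it
  relies on characteristic zero.\<close>

definition divided_power :: "('a fps \<Rightarrow> 'a fps) \<Rightarrow> nat \<Rightarrow> 'a fps \<Rightarrow> 'a fps"
  where "divided_power D j F = fscale (fps_const (1 / fact j)) ((D ^^ j) F)"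

text \<open>Coefficient \<open>m\<close> stops the exponential series at \<open>j = m\<close>. When
  \<open>D\<close> takes values in the multiples of \<nu>, the later terms vanish up to order
  \<open>m\<close>, so nothing is lost.\<close>

definition fps_exp_map :: "('a fps \<Rightarrow> 'a fps) \<Rightarrow> 'a fps \<Rightarrow> 'a fps"
  where "fps_exp_map D F = Abs_fps (\<lambda>m. \<Sum>j\<le>m. fps_nth (divided_power D j F) m)"

lemma divided_power_0 [simp]: "divided_power D 0 F = F"
  by (simp add: divided_power_def)

lemma fps_linear_divided_power:
  assumes "fps_linear D"
  shows "fps_linear (divided_power D j)"
proof -
  have "fps_linear (D ^^ j)"
    by (induction j) (simp_all add: fps_linear_id fps_linear_comp [OF assms] id_def comp_def)
  then show ?thesis
    unfolding divided_power_def by (rule fps_linear_fscale)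
qed

lemma divided_power_Suc:
  assumes "fps_linear D"
  shows "D (divided_power D j F) = fscale (of_nat (Suc j)) (divided_power D (Suc j) F)"
proof -
  have "of_nat (Suc j) * fps_const (1 / fact (Suc j)) = (fps_const (1 / fact j) :: 'f fps)"
    by (simp add: fps_of_nat [symmetric] del: of_nat_Suc fps_of_nat)
  then show ?thesis
    by (simp add: divided_power_def fps_linearD [OF assms] del: of_nat_Suc)
qed

text \<open>Each application of \<open>D\<close> gains \<open>s\<close> orders. The value
  \<open>s = 1\<close> makes the exponential converge; a general \<open>s\<close> isolates its
  leading term.\<close>

lemma divided_power_nth_eq_0:
  assumes D: "fps_linear D" "\<And>F i. i < s \<Longrightarrow> fps_nth (D F) i = 0" and "i < s * j"
  shows "fps_nth (divided_power D j F) i = 0"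
proof -
  have "\<forall>i < s * j. fps_nth ((D ^^ j) F) i = 0"
  proof (induction j)
    case (Suc j)
    have "D ((D ^^ j) F) = fscale (fps_X ^ (s * j)) (D (fps_shift (s * j) ((D ^^ j) F)))"
      by (subst fps_eq_X_power_shift [OF Suc]) (rule fps_linearD [OF D(1)])
    then show ?case by (auto simp: D(2))
  qed auto
  then show ?thesis using assms(3) by (simp add: divided_power_def)
qed

lemma fps_exp_map_nth:
  assumes "fps_linear D" "\<And>F. fps_nth (D F) 0 = 0" "m \<le> M"
  shows "fps_nth (fps_exp_map D F) m = (\<Sum>j\<le>M. fps_nth (divided_power D j F) m)"
proof -
  have "(\<Sum>j\<le>m. fps_nth (divided_power D j F) m) = (\<Sum>j\<le>M. fps_nth (divided_power D j F) m)"
    using assms(3) by (intro sum.mono_neutral_left)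
      (auto intro!: divided_power_nth_eq_0 [OF assms(1), where s = 1] simp: assms(2))
  then show ?thesis by (simp add: fps_exp_map_def)
qed

lemma fps_linear_exp_map:
  assumes "fps_linear D" "\<And>F. fps_nth (D F) 0 = 0"
  shows "fps_linear (fps_exp_map D)"
proof (rule fps_linearI)
  note lin = fps_linearD [OF fps_linear_divided_power [OF assms(1)]]
  fix F G :: "'a fps" and c :: 'f
  show "fps_exp_map D (F + G) = fps_exp_map D F + fps_exp_map D G"
    by (rule fps_ext) (simp add: fps_exp_map_def lin sum.distrib)
  show "fps_exp_map D (fscale (fps_const c) F) = fscale (fps_const c) (fps_exp_map D F)"
    by (rule fps_ext) (simp add: fps_exp_map_def lin scale_sum_right)
  show "fps_exp_map D (fscale fps_X F) = fscale fps_X (fps_exp_map D F)"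
  proof (rule fps_ext)
    fix n
    show "fps_nth (fps_exp_map D (fscale fps_X F)) n = fps_nth (fscale fps_X (fps_exp_map D F)) n"
      \<comment> \<open>The extra term \<open>j = n\<close> vanishes at order \<open>n - 1\<close>,
        so both sides can sum over \<open>j \<le> n\<close>.\<close>
      using fps_exp_map_nth [OF assms, of "n - 1" n F]
      by (cases n) (simp_all add: fps_exp_map_def [of D "fscale fps_X F"] lin del: sum.atMost_Suc)
  qed
qed

text \<open>The Leibniz rule for iterated derivations. Applying \<open>D\<close> raises one index of
  a pair, and the weights \<open>i\<close> and \<open>Suc j - i\<close> with which a new pair is
  reached add up to \<open>Suc j\<close>.\<close>

lemma divided_power_bilinear:
  assumes D: "fps_linear D" and B: "fps_bilinear B"
    and der: "\<And>F G. D (B F G) = B (D F) G + B F (D G)"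
  shows "divided_power D j (B F G) = (\<Sum>i\<le>j. B (divided_power D i F) (divided_power D (j - i) G))"
proof (induction j)
  case (Suc j)
  let ?b = "\<lambda>i l. B (divided_power D i F) (divided_power D l G)"
  have "fscale (of_nat (Suc j)) (divided_power D (Suc j) (B F G)) = D (divided_power D j (B F G))"
    by (simp add: divided_power_Suc [OF D] del: of_nat_Suc)
  also have "\<dots> = (\<Sum>i\<le>j. fscale (of_nat (Suc i)) (?b (Suc i) (j - i))
      + fscale (of_nat (Suc (j - i))) (?b i (Suc (j - i))))"
    by (simp add: Suc fps_linearD [OF D] der divided_power_Suc [OF D] fps_bilinear_left [OF B]
        fps_bilinear_right [OF B] del: of_nat_Suc)
  also have "\<dots> = (\<Sum>i\<le>j. fscale (of_nat (Suc i)) (?b (Suc i) (Suc j - Suc i)))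
      + (\<Sum>i\<le>j. fscale (of_nat (Suc j - i)) (?b i (Suc j - i)))"
    by (simp add: sum.distrib Suc_diff_le del: of_nat_Suc)
  \<comment> \<open>Both sums are extended to all pairs with index sum \<open>Suc j\<close>: the
    term \<open>i = 0\<close> added here has weight 0, as has the term \<open>i = Suc j\<close>
    added to the other sum.\<close>
  also have "(\<Sum>i\<le>j. fscale (of_nat (Suc i)) (?b (Suc i) (Suc j - Suc i)))
      = (\<Sum>i\<le>Suc j. fscale (of_nat i) (?b i (Suc j - i)))"
    by (simp add: sum.atMost_Suc_shift del: of_nat_Suc sum.atMost_Suc)
  also have "(\<Sum>i\<le>j. fscale (of_nat (Suc j - i)) (?b i (Suc j - i)))
      = (\<Sum>i\<le>Suc j. fscale (of_nat (Suc j - i)) (?b i (Suc j - i)))"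
    by simp
  also have "(\<Sum>i\<le>Suc j. fscale (of_nat i) (?b i (Suc j - i)))
      + (\<Sum>i\<le>Suc j. fscale (of_nat (Suc j - i)) (?b i (Suc j - i)))
      = (\<Sum>i\<le>Suc j. fscale (of_nat (Suc j)) (?b i (Suc j - i)))"
    unfolding sum.distrib [symmetric]
    by (intro sum.cong refl)
      (simp add: fps.scale_left_distrib [symmetric] of_nat_add [symmetric] del: of_nat_Suc of_nat_add)
  also have "\<dots> = fscale (of_nat (Suc j)) (\<Sum>i\<le>Suc j. ?b i (Suc j - i))"
    by (simp only: fps.scale_sum_right)
  finally have "fscale (of_nat (Suc j)) (divided_power D (Suc j) (B F G))
      = fscale (of_nat (Suc j)) (\<Sum>i\<le>Suc j. ?b i (Suc j - i))" .
  \<comment> \<open>In characteristic zero \<open>Suc j\<close> is invertible as a constant series,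
    so it cancels.\<close>
  then have "fscale (fps_const (1 / of_nat (Suc j))) (fscale (of_nat (Suc j)) (divided_power D (Suc j) (B F G)))
      = fscale (fps_const (1 / of_nat (Suc j))) (fscale (of_nat (Suc j)) (\<Sum>i\<le>Suc j. ?b i (Suc j - i)))"
    by simp
  moreover have "fps_const (1 / of_nat (Suc j)) * of_nat (Suc j) = (1 :: 'f fps)"
    by (simp add: fps_of_nat [symmetric] del: of_nat_Suc fps_of_nat)
  ultimately show ?case
    by (simp del: of_nat_Suc sum.atMost_Suc)
qed simp

text \<open>Both the associative product and a Poisson bracket are instances of \<open>B\<close>.\<close>

lemma fps_exp_map_bilinear:
  assumes D: "fps_linear D" "\<And>F. fps_nth (D F) 0 = 0" and B: "fps_bilinear B"
    and der: "\<And>F G. D (B F G) = B (D F) G + B F (D G)"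
  shows "fps_exp_map D (B F G) = B (fps_exp_map D F) (fps_exp_map D G)"
proof (rule fps_ext)
  fix m
  let ?b = "\<lambda>i l. fps_nth (B (divided_power D i F) (divided_power D l G)) m"
  \<comment> \<open>Up to order \<open>m\<close> the exponentials may be replaced by finite sums,
    over which \<open>B\<close> distributes.\<close>
  let ?T = "\<lambda>F. \<Sum>j\<le>m. divided_power D j F"
  have T: "\<forall>i<Suc m. fps_nth (fps_exp_map D F) i = fps_nth (?T F) i" for F
    by (auto simp: fps_exp_map_nth [OF D, of _ m] fps_sum_nth)
  have 0: "?b i l = 0" if "m < i + l" for i l
    by (rule fps_bilinear_nth_eq_0 [OF B, where k = i and l = l])
      (use that in \<open>auto intro!: divided_power_nth_eq_0 [OF D(1), where s = 1] simp: D(2)\<close>)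
  have "fps_nth (B (fps_exp_map D F) (fps_exp_map D G)) m = fps_nth (B (?T F) (?T G)) m"
    by (rule fps_bilinear_nth_cong [OF B T T]) simp
  also have "\<dots> = (\<Sum>i\<le>m. \<Sum>l\<le>m. ?b i l)"
    by (simp add: fps_bilinear_left [OF B] fps_bilinear_right [OF B] fps_sum_nth) (rule sum.swap)
  also have "\<dots> = sum (\<lambda>(i, l). ?b i l) ({..m} \<times> {..m})"
    by (simp add: sum.cartesian_product)
  \<comment> \<open>The pairs of the square outside the triangle start at an order beyond
    \<open>m\<close>.\<close>
  also have "\<dots> = sum (\<lambda>(i, l). ?b i l) {(i, l). i + l \<le> m}"
    by (intro sum.mono_neutral_right) (auto intro: 0)
  also have "\<dots> = (\<Sum>j\<le>m. \<Sum>i\<le>j. ?b i (j - i))"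
    by (rule sum.triangle_reindex_eq)
  also have "\<dots> = fps_nth (fps_exp_map D (B F G)) m"
    by (simp add: fps_exp_map_def divided_power_bilinear [OF D(1) B der] fps_sum_nth)
  finally show "fps_nth (fps_exp_map D (B F G)) m = fps_nth (B (fps_exp_map D F) (fps_exp_map D G)) m"
    by simp
qed

text \<open>The device for all corrections below. Terms with \<open>j \<ge> 2\<close> start at order
  \<open>2 * s\<close>, so the exponential is the identity below order \<open>s\<close> and adds
  only the leading part of \<open>L\<close> at order \<open>s\<close>.\<close>

lemma fps_exp_map_X_power_nth:
  assumes L: "fps_linear L" and s: "1 \<le> s" "m \<le> s"
  shows "fps_nth (fps_exp_map (\<lambda>F. fscale (fps_X ^ s) (L F)) F) m
    = fps_nth F m + (if m = s then fps_nth (L F) 0 else 0)"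
proof -
  let ?D = "\<lambda>F. fscale (fps_X ^ s) (L F)"
  have D: "fps_linear ?D" "fps_nth (?D F) 0 = 0" for F
    using s by (simp_all add: L fps_linear_fscale)
  have *: "fps_nth (divided_power ?D j F) m = 0" if "j \<noteq> 0" "j \<noteq> 1" for j
  proof (rule divided_power_nth_eq_0 [OF D(1), where s = s])
    have "s * 1 < s * j" using s that by (intro mult_strict_left_mono) auto
    then show "m < s * j" using s by linarith
  qed simp
  \<comment> \<open>The bound \<open>Suc m\<close> instead of \<open>m\<close> keeps the index 1 in
    range even for \<open>m = 0\<close>.\<close>
  have "fps_nth (fps_exp_map ?D F) m = (\<Sum>j\<le>Suc m. fps_nth (divided_power ?D j F) m)"
    by (rule fps_exp_map_nth [OF D]) simp
  also have "\<dots> = (\<Sum>j\<in>{0, 1}. fps_nth (divided_power ?D j F) m)"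
    using * by (intro sum.mono_neutral_right) auto
  also have "\<dots> = fps_nth F m + (if m = s then fps_nth (L F) 0 else 0)"
    using s by (simp add: divided_power_def)
  finally show ?thesis .
qed

end

section \<open>Multiderivations and the Poisson differential\<close>

lemma shuffle_perms_2_0: "shuffle_perms 2 0 = {id}"
proof -
  have "{..<2::nat} = {0, 1}" by auto
  moreover have "strict_mono_on {0, 1} \<sigma> \<longleftrightarrow> \<sigma> 0 < \<sigma> 1" for \<sigma> :: "nat \<Rightarrow> nat"
    by (auto simp: strict_mono_on_def)
  ultimately have "shuffle_perms 2 0 = {\<sigma>. (\<sigma> = id \<or> \<sigma> = transpose 0 1) \<and> \<sigma> 0 < \<sigma> 1}"
    by (simp add: shuffle_perms_def permutes_doubleton_iff)
  also have "\<dots> = {id}" by auto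
  finally show ?thesis .
qed

lemma shuffle_perms_1_1: "shuffle_perms 1 1 = {id, transpose 0 1}"
proof -
  have "{..<2::nat} = {0, 1}" "{..<1::nat} = {0}" "{1..<2::nat} = {1}" by auto
  then show ?thesis
    by (auto simp: shuffle_perms_def permutes_doubleton_iff strict_mono_on_def)
qed

lemma shuffle_perms_0_1: "shuffle_perms 0 1 = {id}"
proof -
  have "{..<1::nat} = {0}" by auto
  then show ?thesis
    by (auto simp: shuffle_perms_def strict_mono_on_def)
qed

text \<open>A (2,1)-shuffle is determined by its value at 2; the values 2, 1, 0 give the three
  permutations in the listed order.\<close>

lemma shuffle_perms_2_1:
  "shuffle_perms 2 1 = {id, transpose 1 2, transpose 0 1 \<circ> transpose 1 2}"
proof (intro equalityI subsetI)
  have 3: "{..<3::nat} = {0, 1, 2}" by auto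
  have perms: "transpose 0 1 \<circ> transpose 1 2 permutes {0, 1, 2::nat}" "transpose 1 2 permutes {0, 1, 2::nat}"
    by (auto intro!: permutes_compose permutes_swap_id)
  fix \<sigma> :: "nat \<Rightarrow> nat"
  { assume "\<sigma> \<in> shuffle_perms 2 1"
    then have p: "\<sigma> permutes {0, 1, 2}" and lt: "\<sigma> 0 < \<sigma> 1"
      by (auto simp: shuffle_perms_def strict_mono_on_def 3)
    \<comment> \<open>Permutations of \<open>{0, 1, 2}\<close> fix every other number, so three
      values decide equality.\<close>
    have eq: "\<sigma> = \<tau>" if "\<sigma> 0 = \<tau> 0" "\<sigma> 1 = \<tau> 1" "\<sigma> 2 = \<tau> 2" "\<tau> permutes {0, 1, 2}" for \<tau>
    proof
      fix x
      show "\<sigma> x = \<tau> x"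
        using that permutes_not_in [OF p, of x] permutes_not_in [OF that(4), of x]
        by (cases "x \<in> {0, 1, 2}") auto
    qed
    have "\<sigma> 0 \<in> {0, 1, 2}" "\<sigma> 1 \<in> {0, 1, 2}" "\<sigma> 2 \<in> {0, 1, 2}"
      using permutes_in_image [OF p] by blast+
    moreover have "\<sigma> 0 \<noteq> \<sigma> 2" "\<sigma> 1 \<noteq> \<sigma> 2"
      using inj_eq [OF permutes_inj [OF p]] by auto
    ultimately consider "\<sigma> 0 = 0" "\<sigma> 1 = 1" "\<sigma> 2 = 2" | "\<sigma> 0 = 0" "\<sigma> 1 = 2" "\<sigma> 2 = 1"
      | "\<sigma> 0 = 1" "\<sigma> 1 = 2" "\<sigma> 2 = 0"
      using lt by auto
    then show "\<sigma> \<in> {id, transpose 1 2, transpose 0 1 \<circ> transpose 1 2}"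
    proof cases
      case 1
      then show ?thesis using eq [of id] by (simp add: permutes_id)
    next
      case 2
      then show ?thesis using eq [of "transpose 1 2"] perms(2) by (simp add: transpose_def)
    next
      case 3
      then show ?thesis using eq [of "transpose 0 1 \<circ> transpose 1 2"] perms(1) by (simp add: transpose_def)
    qed }
  assume "\<sigma> \<in> {id, transpose 1 2, transpose 0 1 \<circ> transpose 1 2}"
  with perms show "\<sigma> \<in> shuffle_perms 2 1"
    by (auto simp: shuffle_perms_def strict_mono_on_def permutes_id transpose_def 3)
qed

context comm_algebra
begin

lemma linear_scale_iff:
  "Vector_Spaces.linear scale scale f \<longleftrightarrow>
    (\<forall>x y. f (x + y) = f x + f y) \<and> (\<forall>c x. f (scale c x) = scale c (f x))"
  by (simp add: Vector_Spaces.linear_iff vector_space_axioms)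

lemma multiderivations_1D:
  assumes "V \<in> multiderivations scale 1"
  shows "V [x + y] = V [x] + V [y]" "V [scale c x] = scale c (V [x])"
    "V [x * y] = x * V [y] + y * V [x]"
proof -
  \<comment> \<open>The entry of \<open>[0]\<close> is a placeholder that the update overwrites; it
    brings \<open>V [x]\<close> into the form of the definition.\<close>
  have "Vector_Spaces.linear scale scale (\<lambda>x. V ([0][0 := x])) \<and>
      (\<forall>x y. V ([0][0 := x * y]) = x * V ([0][0 := y]) + y * V ([0][0 := x]))"
    using assms by (auto simp: multiderivations_def simp del: list_update.simps)
  then show "V [x + y] = V [x] + V [y]" "V [scale c x] = scale c (V [x])"
    "V [x * y] = x * V [y] + y * V [x]"
    by (simp_all add: linear_scale_iff)
qed

lemma multiderivations_eq_0: "P \<in> multiderivations scale k \<Longrightarrow> length Fs \<noteq> k \<Longrightarrow> P Fs = 0"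
  by (simp add: multiderivations_def)

lemma multiderivations_2D:
  assumes "P \<in> multiderivations scale 2"
  shows "P [x + y, z] = P [x, z] + P [y, z]" "P [scale c x, z] = scale c (P [x, z])"
    "P [x * y, z] = x * P [y, z] + y * P [x, z]"
    "P [z, x + y] = P [z, x] + P [z, y]" "P [z, scale c x] = scale c (P [z, x])"
    "P [y, x] = - P [x, y]"
proof -
  have "\<forall>i<2. Vector_Spaces.linear scale scale (\<lambda>x. P ([u, v][i := x])) \<and>
      (\<forall>x y. P ([u, v][i := x * y]) = x * P ([u, v][i := y]) + y * P ([u, v][i := x]))" for u v
    using assms by (simp add: multiderivations_def del: list_update.simps)
  from this [of _ z, rule_format, of 0] this [of z, rule_format, of 1]
  show "P [x + y, z] = P [x, z] + P [y, z]" "P [scale c x, z] = scale c (P [x, z])"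
    "P [x * y, z] = x * P [y, z] + y * P [x, z]"
    "P [z, x + y] = P [z, x] + P [z, y]" "P [z, scale c x] = scale c (P [z, x])"
    by (simp_all add: linear_scale_iff)
  have "transpose 0 1 permutes {..<2::nat}"
    by (intro permutes_swap_id) auto
  then have "P (permute_list (transpose 0 1) [x, y])
      = scale (of_int (sign (transpose (0::nat) 1))) (P [x, y])"
    using assms by (simp add: multiderivations_def)
  then show "P [y, x] = - P [x, y]"
    by (simp add: permute_list_def sign_swap_id)
qed

lemma multiderivations_2_neg: "P \<in> multiderivations scale 2 \<Longrightarrow> P [- x, z] = - P [x, z]"
  using multiderivations_2D(2) [of P "- 1" x z] by simp

lemma multiderivations_2_0:
  assumes "P \<in> multiderivations scale 2"
  shows "P [0, z] = 0" "P [z, 0] = 0"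
  using multiderivations_2D(2) [OF assms, of 0 0] multiderivations_2D(5) [OF assms, of _ 0 0] by auto

lemma multiderivations_1I:
  assumes "\<And>x y. v (x + y) = v x + v y" "\<And>c x. v (scale c x) = scale c (v x)"
    "\<And>x y. v (x * y) = x * v y + y * v x"
  shows "(\<lambda>Fs. if length Fs = 1 then v (hd Fs) else 0) \<in> multiderivations scale 1"
proof -
  have "{..<1::nat} = {0}" by auto
  then show ?thesis
    using assms by (auto simp: multiderivations_def linear_scale_iff length_Suc_conv)
qed

text \<open>Skew-symmetry carries linearity and the Leibniz rule over to the second slot, and the
  only permutations to check are the identity and one transposition.\<close>

lemma multiderivations_2I:
  assumes "\<And>x y z. p (x + y) z = p x z + p y z" "\<And>c x z. p (scale c x) z = scale c (p x z)"
    "\<And>x y z. p (x * y) z = x * p y z + y * p x z" "\<And>x y. p y x = - p x y"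
  shows "(\<lambda>Fs. if length Fs = 2 then p (Fs ! 0) (Fs ! 1) else 0) \<in> multiderivations scale 2"
proof -
  have right: "p z (x + y) = p z x + p z y" "p z (scale c x) = scale c (p z x)"
    "p z (x * y) = x * p z y + y * p z x" for x y z c
    using assms(1,3) [of x y z] assms(2) [of c x z] assms(4) [of z] by simp_all
  have two: "{..<2::nat} = {0, 1}" by auto
  show ?thesis
    unfolding multiderivations_def mem_Collect_eq
  proof (intro conjI allI impI)
    fix Fs :: "'a list" and i :: nat
    assume "length Fs = 2 \<and> i < 2"
    then obtain u v where "Fs = [u, v]" "i = 0 \<or> i = 1"
      by (auto simp: length_Suc_conv numeral_2_eq_2 less_Suc_eq)
    then show "Vector_Spaces.linear scale scale
        (\<lambda>x. if length (Fs[i := x]) = 2 then p (Fs[i := x] ! 0) (Fs[i := x] ! 1) else 0)"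
      and "\<And>x y. (if length (Fs[i := x * y]) = 2 then p (Fs[i := x * y] ! 0) (Fs[i := x * y] ! 1) else 0) =
        x * (if length (Fs[i := y]) = 2 then p (Fs[i := y] ! 0) (Fs[i := y] ! 1) else 0) +
        y * (if length (Fs[i := x]) = 2 then p (Fs[i := x] ! 0) (Fs[i := x] ! 1) else 0)"
      by (auto simp: linear_scale_iff assms(1-3) right)
  next
    fix Fs :: "'a list" and \<sigma> :: "nat \<Rightarrow> nat"
    assume *: "length Fs = 2 \<and> \<sigma> permutes {..<2}"
    then obtain u v where Fs: "Fs = [u, v]"
      by (auto simp: length_Suc_conv numeral_2_eq_2)
    from * have "\<sigma> = id \<or> \<sigma> = transpose 0 1"
      by (simp add: two permutes_doubleton_iff)
    then show "(if length (permute_list \<sigma> Fs) = 2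
          then p (permute_list \<sigma> Fs ! 0) (permute_list \<sigma> Fs ! 1) else 0)
        = scale (of_int (sign \<sigma>)) (if length Fs = 2 then p (Fs ! 0) (Fs ! 1) else 0)"
      using assms(4) [of v u]
      by (auto simp: Fs permute_list_def sign_swap_id)
  qed simp
qed

section \<open>Linear structure of multiderivations, cocycles and coboundaries\<close>

definition pointwise_subspace :: "('b \<Rightarrow> 'a) set \<Rightarrow> bool"
  where "pointwise_subspace S \<longleftrightarrow> (\<lambda>_. 0) \<in> S \<and> (\<forall>P\<in>S. \<forall>Q\<in>S. (\<lambda>x. P x + Q x) \<in> S) \<and>
    (\<forall>c. \<forall>P\<in>S. (\<lambda>x. scale c (P x)) \<in> S)"

lemma pointwise_subspaceD:
  assumes "pointwise_subspace S"
  shows "(\<lambda>_. 0) \<in> S" "P \<in> S \<Longrightarrow> Q \<in> S \<Longrightarrow> (\<lambda>x. P x + Q x) \<in> S"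
    "P \<in> S \<Longrightarrow> (\<lambda>x. scale c (P x)) \<in> S" "P \<in> S \<Longrightarrow> (\<lambda>x. - P x) \<in> S"
    "P \<in> S \<Longrightarrow> Q \<in> S \<Longrightarrow> (\<lambda>x. P x - Q x) \<in> S"
proof -
  show 0: "(\<lambda>_. 0) \<in> S" and add: "\<And>P Q. P \<in> S \<Longrightarrow> Q \<in> S \<Longrightarrow> (\<lambda>x. P x + Q x) \<in> S"
    and sc: "\<And>P c. P \<in> S \<Longrightarrow> (\<lambda>x. scale c (P x)) \<in> S"
    using assms by (auto simp: pointwise_subspace_def)
  show min: "\<And>P. P \<in> S \<Longrightarrow> (\<lambda>x. - P x) \<in> S"
    using sc [of _ "- 1"] by simp
  show "P \<in> S \<Longrightarrow> Q \<in> S \<Longrightarrow> (\<lambda>x. P x - Q x) \<in> S"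
    using add [of P "\<lambda>x. - Q x"] min by simp
qed

lemma pointwise_subspace_sum:
  assumes "pointwise_subspace S" "\<And>k. k \<in> A \<Longrightarrow> P k \<in> S"
  shows "(\<lambda>x. \<Sum>k\<in>A. scale (c k) (P k x)) \<in> S"
  using assms(2)
proof (induction A rule: infinite_finite_induct)
  case (insert k A)
  then have "(\<lambda>x. scale (c k) (P k x)) \<in> S" "(\<lambda>x. \<Sum>k\<in>A. scale (c k) (P k x)) \<in> S"
    using pointwise_subspaceD(3) [OF assms(1)] by auto
  from pointwise_subspaceD(2) [OF assms(1) this] insert show ?case by simp
qed (auto simp: pointwise_subspaceD(1) [OF assms(1)])

lemma multiderivationsD:
  assumes "P \<in> multiderivations scale k" "length Fs = k"
  shows "i < k \<Longrightarrow> P (Fs[i := x + y]) = P (Fs[i := x]) + P (Fs[i := y])"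
    "i < k \<Longrightarrow> P (Fs[i := scale c x]) = scale c (P (Fs[i := x]))"
    "i < k \<Longrightarrow> P (Fs[i := x * y]) = x * P (Fs[i := y]) + y * P (Fs[i := x])"
    "\<sigma> permutes {..<k} \<Longrightarrow> P (permute_list \<sigma> Fs) = scale (of_int (sign \<sigma>)) (P Fs)"
  using assms by (simp_all add: multiderivations_def linear_scale_iff)

lemma multiderivationsI:
  assumes "\<And>Fs. length Fs \<noteq> k \<Longrightarrow> P Fs = 0"
    "\<And>Fs i x y. length Fs = k \<Longrightarrow> i < k \<Longrightarrow> P (Fs[i := x + y]) = P (Fs[i := x]) + P (Fs[i := y])"
    "\<And>Fs i c x. length Fs = k \<Longrightarrow> i < k \<Longrightarrow> P (Fs[i := scale c x]) = scale c (P (Fs[i := x]))"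
    "\<And>Fs i x y. length Fs = k \<Longrightarrow> i < k \<Longrightarrow> P (Fs[i := x * y]) = x * P (Fs[i := y]) + y * P (Fs[i := x])"
    "\<And>Fs \<sigma>. length Fs = k \<Longrightarrow> \<sigma> permutes {..<k} \<Longrightarrow> P (permute_list \<sigma> Fs) = scale (of_int (sign \<sigma>)) (P Fs)"
  shows "P \<in> multiderivations scale k"
  using assms by (simp add: multiderivations_def linear_scale_iff)

lemma pointwise_subspace_multiderivations: "pointwise_subspace (multiderivations scale k)"
  unfolding pointwise_subspace_def
proof (intro conjI ballI allI)
  show "(\<lambda>_. 0) \<in> multiderivations scale k"
    by (rule multiderivationsI) simp_all
next
  fix P Q assume "P \<in> multiderivations scale k" "Q \<in> multiderivations scale k"
  note * = multiderivations_eq_0 [OF this(1)] multiderivations_eq_0 [OF this(2)]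
    multiderivationsD [OF this(1)] multiderivationsD [OF this(2)]
  show "(\<lambda>Fs. P Fs + Q Fs) \<in> multiderivations scale k"
    by (rule multiderivationsI) (simp_all add: * scale_right_distrib distrib_left add_ac)
next
  fix P c assume "P \<in> multiderivations scale k"
  note * = multiderivations_eq_0 [OF this] multiderivationsD [OF this]
  show "(\<lambda>Fs. scale c (P Fs)) \<in> multiderivations scale k"
  proof (rule multiderivationsI, goal_cases)
    case 1 then show ?case by (simp add: *)
  next case 2 then show ?case by (simp add: * scale_right_distrib)
  next case 3 then show ?case by (simp add: * mult.commute)
  next case (4 Fs i x y) then show ?case by (simp only: * scale_right_distrib scale_mult_right)
  next case 5 then show ?case by (simp add: * mult.commute)
  qed
qed

text \<open>In the second shuffle sum \<open>P\<close> sits inside the first slot of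
  \<open>Q\<close>, whose linearity is used there; the first sum applies \<open>P\<close>
  outermost.\<close>

lemma schouten_linear:
  assumes Q: "Q \<in> multiderivations scale 2"
  shows "schouten scale k 2 (\<lambda>Fs. P Fs + P' Fs) Q Fs
      = schouten scale k 2 P Q Fs + schouten scale k 2 P' Q Fs"
    and "schouten scale k 2 (\<lambda>Fs. scale c (P Fs)) Q Fs = scale c (schouten scale k 2 P Q Fs)"
proof -
  have Q': "Q ((x + x') # Gs) = Q (x # Gs) + Q (x' # Gs)" "Q (scale c x # Gs) = scale c (Q (x # Gs))"
    if "length Gs = 1" for x x' Gs
    using that multiderivations_2D(1,2) [OF Q] by (auto simp: length_Suc_conv)
  show "schouten scale k 2 (\<lambda>Fs. P Fs + P' Fs) Q Fs
      = schouten scale k 2 P Q Fs + schouten scale k 2 P' Q Fs"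
    by (auto simp: schouten_def Let_def Q' scale_right_distrib sum.distrib)
  show "schouten scale k 2 (\<lambda>Fs. scale c (P Fs)) Q Fs = scale c (schouten scale k 2 P Q Fs)"
    by (auto simp: schouten_def Let_def Q' scale_right_diff_distrib scale_sum_right mult_ac)
qed

lemma poisson_delta_linear:
  assumes "\<pi> \<in> multiderivations scale 2"
  shows "poisson_delta scale \<pi> k (\<lambda>Fs. P Fs + P' Fs)
      = (\<lambda>Fs. poisson_delta scale \<pi> k P Fs + poisson_delta scale \<pi> k P' Fs)"
    and "poisson_delta scale \<pi> k (\<lambda>Fs. scale c (P Fs)) = (\<lambda>Fs. scale c (poisson_delta scale \<pi> k P Fs))"
  by (auto simp: poisson_delta_def schouten_linear [OF assms])

lemma poisson_delta_zero:
  assumes "\<pi> \<in> multiderivations scale 2"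
  shows "poisson_delta scale \<pi> k (\<lambda>_. 0) = (\<lambda>_. 0)"
  using poisson_delta_linear(2) [OF assms, of k 0] by simp

lemma pointwise_subspace_cocycles:
  assumes "\<pi> \<in> multiderivations scale 2"
  shows "pointwise_subspace (poisson_cocycles scale \<pi> k)"
  using pointwise_subspace_multiderivations [of k]
  by (simp add: pointwise_subspace_def poisson_cocycles_def poisson_delta_linear [OF assms]
      poisson_delta_zero [OF assms])

lemma pointwise_subspace_coboundaries:
  assumes "\<pi> \<in> multiderivations scale 2"
  shows "pointwise_subspace (poisson_coboundaries scale \<pi> k)"
  unfolding pointwise_subspace_def poisson_coboundaries_def
proof (intro conjI ballI allI)
  note * = pointwise_subspaceD [OF pointwise_subspace_multiderivations [of "k - 1"]]
  show "(\<lambda>_. 0) \<in> poisson_delta scale \<pi> (k - 1) ` multiderivations scale (k - 1)"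
    using poisson_delta_zero [OF assms] *(1) by (metis image_eqI)
  show "(\<lambda>x. P x + Q x) \<in> poisson_delta scale \<pi> (k - 1) ` multiderivations scale (k - 1)"
    if "P \<in> poisson_delta scale \<pi> (k - 1) ` multiderivations scale (k - 1)"
      "Q \<in> poisson_delta scale \<pi> (k - 1) ` multiderivations scale (k - 1)" for P Q
    using that *(2) by (auto simp flip: poisson_delta_linear(1) [OF assms])
  show "(\<lambda>x. scale c (P x)) \<in> poisson_delta scale \<pi> (k - 1) ` multiderivations scale (k - 1)"
    if "P \<in> poisson_delta scale \<pi> (k - 1) ` multiderivations scale (k - 1)" for P c
    using that *(3) by (auto simp flip: poisson_delta_linear(2) [OF assms])
qed

section \<open>The differential in degrees 0, 1 and 2\<close>

text \<open>In degree 0 the first shuffle sum is empty, and the sign \<open>(- 1) powi (- 1)\<close>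
  of the second leaves minus the Hamiltonian derivation of \<open>P []\<close>.\<close>

lemma poisson_delta_0: "poisson_delta scale \<pi> 0 P [x] = - \<pi> [P [], x]"
proof -
  have "shuffle_perms 2 (- 1) = {}" by (simp add: shuffle_perms_def)
  then show ?thesis
    by (simp add: poisson_delta_def schouten_def shuffle_perms_0_1 Let_def)
qed

text \<open>For skew \<open>\<pi>\<close> the middle term equals \<open>+ \<pi> [x, V [y]]\<close>,
  so the coboundary measures the failure of \<open>V\<close> to be a derivation of the
  bracket.\<close>

lemma poisson_delta_1: "poisson_delta scale \<pi> 1 V [x, y] = \<pi> [V [x], y] - \<pi> [V [y], x] - V [\<pi> [x, y]]"
proof -
  have "id \<noteq> transpose 0 (1::nat)"
    by (auto simp: fun_eq_iff transpose_def)
  then show ?thesis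
    by (simp add: poisson_delta_def schouten_def shuffle_perms_2_0 shuffle_perms_1_1 Let_def
        permute_list_def sign_swap_id)
qed

text \<open>For skew maps this is minus the linearisation of the Jacobi identity at
  \<open>\<pi>\<close> in the direction \<open>P\<close>.\<close>

lemma poisson_delta_2: "poisson_delta scale \<pi> 2 P [x, y, z] =
  - (P [\<pi> [x, y], z] - P [\<pi> [x, z], y] + P [\<pi> [y, z], x]
    + \<pi> [P [x, y], z] - \<pi> [P [x, z], y] + \<pi> [P [y, z], x])"
proof -
  have "sign (transpose 0 1 \<circ> transpose 1 (2::nat)) = 1"
    by (simp add: sign_compose permutation_swap_id sign_swap_id)
  moreover have "id \<noteq> transpose 1 (2::nat)" "id \<noteq> transpose 0 1 \<circ> transpose 1 (2::nat)"
    "transpose 1 (2::nat) \<noteq> transpose 0 1 \<circ> transpose 1 2"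
    by (auto simp: fun_eq_iff transpose_def)
  ultimately show ?thesis
    by (simp add: poisson_delta_def schouten_def shuffle_perms_2_1 Let_def permute_list_def
        sign_swap_id upt_rec transpose_def)
qed

lemma poisson_delta_length: "length Fs \<noteq> Suc k \<Longrightarrow> poisson_delta scale \<pi> k P Fs = 0"
  by (simp add: poisson_delta_def schouten_def)

end

section \<open>Finite sums in Poisson cohomology\<close>

context comm_algebra
begin

context
  fixes \<pi> :: "'a list \<Rightarrow> 'a" and k :: nat
  assumes \<pi>: "\<pi> \<in> multiderivations scale 2"
begin

lemma cohomology_class_iff:
  "Q \<in> cohomology_class scale \<pi> k P \<longleftrightarrow> (\<lambda>Fs. Q Fs - P Fs) \<in> poisson_coboundaries scale \<pi> k"
proof
  assume "(\<lambda>Fs. Q Fs - P Fs) \<in> poisson_coboundaries scale \<pi> k"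
  then show "Q \<in> cohomology_class scale \<pi> k P"
    unfolding cohomology_class_def by (intro CollectI exI [of _ "\<lambda>Fs. Q Fs - P Fs"]) simp
qed (auto simp: cohomology_class_def)

lemma cohomology_class_refl: "P \<in> cohomology_class scale \<pi> k P"
  using pointwise_subspaceD(1) [OF pointwise_subspace_coboundaries [OF \<pi>]]
  by (simp add: cohomology_class_iff)

lemma cohomology_class_zero: "cohomology_class scale \<pi> k (\<lambda>_. 0) = poisson_coboundaries scale \<pi> k"
  by (auto simp: cohomology_class_iff)

lemma cohomology_class_cong:
  assumes "(\<lambda>Fs. P Fs - Q Fs) \<in> poisson_coboundaries scale \<pi> k"
  shows "cohomology_class scale \<pi> k P = cohomology_class scale \<pi> k Q"
proof (rule Set.set_eqI)
  note sub = pointwise_subspaceD(2,5) [OF pointwise_subspace_coboundaries [OF \<pi>]]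
  fix R
  show "R \<in> cohomology_class scale \<pi> k P \<longleftrightarrow> R \<in> cohomology_class scale \<pi> k Q"
    using sub(1) [OF _ assms, of "\<lambda>Fs. R Fs - P Fs"] sub(2) [OF _ assms, of "\<lambda>Fs. R Fs - Q Fs"]
    by (auto simp: cohomology_class_iff)
qed

lemma cohomology_class_add:
  "{(\<lambda>Fs. P' Fs + Q' Fs) | P' Q'. P' \<in> cohomology_class scale \<pi> k P \<and> Q' \<in> cohomology_class scale \<pi> k Q}
    = cohomology_class scale \<pi> k (\<lambda>Fs. P Fs + Q Fs)"
proof (intro equalityI subsetI)
  note sub = pointwise_subspaceD [OF pointwise_subspace_coboundaries [OF \<pi>]]
  fix R
  { assume "R \<in> {(\<lambda>Fs. P' Fs + Q' Fs) | P' Q'.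
        P' \<in> cohomology_class scale \<pi> k P \<and> Q' \<in> cohomology_class scale \<pi> k Q}"
    then obtain P' Q' where R: "R = (\<lambda>Fs. P' Fs + Q' Fs)"
      and *: "(\<lambda>Fs. P' Fs - P Fs) \<in> poisson_coboundaries scale \<pi> k"
        "(\<lambda>Fs. Q' Fs - Q Fs) \<in> poisson_coboundaries scale \<pi> k"
      by (auto simp: cohomology_class_iff)
    show "R \<in> cohomology_class scale \<pi> k (\<lambda>Fs. P Fs + Q Fs)"
      using sub(2) [OF *] by (simp add: cohomology_class_iff R algebra_simps) }
  assume "R \<in> cohomology_class scale \<pi> k (\<lambda>Fs. P Fs + Q Fs)"
  then have "(\<lambda>Fs. R Fs - Q Fs) \<in> cohomology_class scale \<pi> k P"
    by (simp add: cohomology_class_iff algebra_simps)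
  then show "R \<in> {(\<lambda>Fs. P' Fs + Q' Fs) | P' Q'.
        P' \<in> cohomology_class scale \<pi> k P \<and> Q' \<in> cohomology_class scale \<pi> k Q}"
    using cohomology_class_refl [of Q]
    by (intro CollectI exI [of _ "\<lambda>Fs. R Fs - Q Fs"] exI [of _ Q]) simp
qed

lemma cohomology_class_scale:
  "{(\<lambda>Fs. scale c (P' Fs) + B Fs) | P' B.
      P' \<in> cohomology_class scale \<pi> k P \<and> B \<in> poisson_coboundaries scale \<pi> k}
    = cohomology_class scale \<pi> k (\<lambda>Fs. scale c (P Fs))"
proof (intro equalityI subsetI)
  note sub = pointwise_subspaceD [OF pointwise_subspace_coboundaries [OF \<pi>]]
  fix R
  { assume "R \<in> {(\<lambda>Fs. scale c (P' Fs) + B Fs) | P' B.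
      P' \<in> cohomology_class scale \<pi> k P \<and> B \<in> poisson_coboundaries scale \<pi> k}"
    then obtain P' B where R: "R = (\<lambda>Fs. scale c (P' Fs) + B Fs)"
      and *: "(\<lambda>Fs. P' Fs - P Fs) \<in> poisson_coboundaries scale \<pi> k" "B \<in> poisson_coboundaries scale \<pi> k"
      by (auto simp: cohomology_class_iff)
    show "R \<in> cohomology_class scale \<pi> k (\<lambda>Fs. scale c (P Fs))"
      using sub(2) [OF sub(3) [OF *(1), of c] *(2)]
      by (simp add: cohomology_class_iff R algebra_simps) }
  assume "R \<in> cohomology_class scale \<pi> k (\<lambda>Fs. scale c (P Fs))"
  then have "(\<lambda>Fs. R Fs - scale c (P Fs)) \<in> poisson_coboundaries scale \<pi> k"
    by (simp add: cohomology_class_iff)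
  then show "R \<in> {(\<lambda>Fs. scale c (P' Fs) + B Fs) | P' B.
      P' \<in> cohomology_class scale \<pi> k P \<and> B \<in> poisson_coboundaries scale \<pi> k}"
    \<comment> \<open>Choosing \<open>P\<close> itself and moving the whole difference into the
      coboundary works for \<open>c = 0\<close> too.\<close>
    using cohomology_class_refl [of P]
    by (intro CollectI exI [of _ P] exI [of _ "\<lambda>Fs. R Fs - scale c (P Fs)"]) simp
qed

text \<open>The rules that evaluate the finite sums in \<open>basis_family\<close> ask for this
  structure.\<close>

lemma abelian_monoid_poisson_cohomology: "abelian_monoid (poisson_cohomology scale \<pi> k)"
proof (rule abelian_monoidI)
  note sub = pointwise_subspaceD [OF pointwise_subspace_cocycles [OF \<pi>]]
  let ?H = "poisson_cohomology scale \<pi> k"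
  have carrier: "carrier ?H = cohomology_class scale \<pi> k ` poisson_cocycles scale \<pi> k"
    and zero: "\<zero>\<^bsub>?H\<^esub> = cohomology_class scale \<pi> k (\<lambda>_. 0)"
    by (simp_all add: poisson_cohomology_def cohomology_class_zero)
  have add: "cohomology_class scale \<pi> k P \<oplus>\<^bsub>?H\<^esub> cohomology_class scale \<pi> k Q
      = cohomology_class scale \<pi> k (\<lambda>Fs. P Fs + Q Fs)" for P Q
    by (simp add: poisson_cohomology_def cohomology_class_add)
  show "\<zero>\<^bsub>?H\<^esub> \<in> carrier ?H"
    using sub(1) by (auto simp: carrier zero)
  show "x \<oplus>\<^bsub>?H\<^esub> y \<in> carrier ?H" if "x \<in> carrier ?H" "y \<in> carrier ?H" for x y
    using that sub(2) by (auto simp: carrier add)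
  show "(x \<oplus>\<^bsub>?H\<^esub> y) \<oplus>\<^bsub>?H\<^esub> z = x \<oplus>\<^bsub>?H\<^esub> (y \<oplus>\<^bsub>?H\<^esub> z)"
    if "x \<in> carrier ?H" "y \<in> carrier ?H" "z \<in> carrier ?H" for x y z
    using that by (auto simp: carrier add add.assoc)
  show "x \<oplus>\<^bsub>?H\<^esub> y = y \<oplus>\<^bsub>?H\<^esub> x" if "x \<in> carrier ?H" "y \<in> carrier ?H" for x y
    using that by (auto simp: carrier add add.commute)
  show "\<zero>\<^bsub>?H\<^esub> \<oplus>\<^bsub>?H\<^esub> x = x" if "x \<in> carrier ?H" for x
    using that by (auto simp: carrier zero add)
qed

text \<open>The bridge from sums of cosets to sums of representatives: addition and scaling of
  cosets act on representatives, and each summand stays in the carrier.\<close>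

lemma finsum_poisson_cohomology:
  assumes "finite A" "\<And>i. i \<in> A \<Longrightarrow> \<theta> i \<in> poisson_cocycles scale \<pi> k"
  defines "H \<equiv> poisson_cohomology scale \<pi> k"
  shows "(\<Oplus>\<^bsub>H\<^esub>i\<in>A. c i \<odot>\<^bsub>H\<^esub> cohomology_class scale \<pi> k (\<theta> i))
    = cohomology_class scale \<pi> k (\<lambda>Fs. \<Sum>i\<in>A. scale (c i) (\<theta> i Fs))"
  using assms(1,2)
proof (induction A rule: finite_induct)
  case empty
  show ?case
    by (simp add: H_def abelian_monoid.finsum_empty [OF abelian_monoid_poisson_cohomology] cohomology_class_zero)
      (simp add: poisson_cohomology_def)
next
  case (insert j A)
  note sub = pointwise_subspaceD [OF pointwise_subspace_cocycles [OF \<pi>]]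
  have smult: "c i \<odot>\<^bsub>H\<^esub> cohomology_class scale \<pi> k (\<theta> i)
      = cohomology_class scale \<pi> k (\<lambda>Fs. scale (c i) (\<theta> i Fs))" for i
    by (simp add: H_def poisson_cohomology_def cohomology_class_scale)
  have closed: "c i \<odot>\<^bsub>H\<^esub> cohomology_class scale \<pi> k (\<theta> i) \<in> carrier H" if "i \<in> insert j A" for i
    unfolding smult using sub(3) insert.prems [OF that]
    by (auto simp: H_def poisson_cohomology_def)
  have "(\<Oplus>\<^bsub>H\<^esub>i\<in>insert j A. c i \<odot>\<^bsub>H\<^esub> cohomology_class scale \<pi> k (\<theta> i))
      = c j \<odot>\<^bsub>H\<^esub> cohomology_class scale \<pi> k (\<theta> j)
        \<oplus>\<^bsub>H\<^esub> (\<Oplus>\<^bsub>H\<^esub>i\<in>A. c i \<odot>\<^bsub>H\<^esub> cohomology_class scale \<pi> k (\<theta> i))"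
    using insert.hyps closed abelian_monoid_poisson_cohomology
    by (intro abelian_monoid.finsum_insert) (auto simp: H_def)
  also have "\<dots> = cohomology_class scale \<pi> k (\<lambda>Fs. scale (c j) (\<theta> j Fs))
      \<oplus>\<^bsub>H\<^esub> cohomology_class scale \<pi> k (\<lambda>Fs. \<Sum>i\<in>A. scale (c i) (\<theta> i Fs))"
    using insert by (simp add: smult)
  also have "\<dots> = cohomology_class scale \<pi> k (\<lambda>Fs. \<Sum>i\<in>insert j A. scale (c i) (\<theta> i Fs))"
    using insert.hyps by (simp add: H_def poisson_cohomology_def cohomology_class_add)
  finally show ?case .
qed

text \<open>The spanning half of \<open>basis_family\<close> for representatives: cocycles with
  equal classes differ by a coboundary.\<close>

lemma basis_family_spans:
  assumes "basis_family (poisson_cohomology scale \<pi> k) K (\<lambda>i. cohomology_class scale \<pi> k (\<theta> i))"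
    and "\<forall>i\<in>K. \<theta> i \<in> poisson_cocycles scale \<pi> k" and "P \<in> poisson_cocycles scale \<pi> k"
  obtains A c where "finite A" "A \<subseteq> K"
    "(\<lambda>Fs. P Fs - (\<Sum>i\<in>A. scale (c i) (\<theta> i Fs))) \<in> poisson_coboundaries scale \<pi> k"
proof -
  have "cohomology_class scale \<pi> k P \<in> carrier (poisson_cohomology scale \<pi> k)"
    using assms(3) by (simp add: poisson_cohomology_def)
  with assms(1) obtain A c where A: "finite A" "A \<subseteq> K"
    and "cohomology_class scale \<pi> k P = (\<Oplus>\<^bsub>poisson_cohomology scale \<pi> k\<^esub>i\<in>A.
      c i \<odot>\<^bsub>poisson_cohomology scale \<pi> k\<^esub> cohomology_class scale \<pi> k (\<theta> i))"
    unfolding basis_family_def by (elim conjE) (drule (1) bspec, elim exE conjE, rule that)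
  then have "cohomology_class scale \<pi> k P = cohomology_class scale \<pi> k (\<lambda>Fs. \<Sum>i\<in>A. scale (c i) (\<theta> i Fs))"
    using assms(2) finsum_poisson_cohomology [of A \<theta> c] by (simp add: subset_iff)
  then show thesis
    using that [OF A] cohomology_class_refl [of P] by (simp add: cohomology_class_iff)
qed

text \<open>The independence half for representatives: a combination that is a coboundary represents
  the zero coset.\<close>

lemma basis_family_independent:
  assumes "basis_family (poisson_cohomology scale \<pi> k) K (\<lambda>i. cohomology_class scale \<pi> k (\<theta> i))"
    and "\<forall>i\<in>K. \<theta> i \<in> poisson_cocycles scale \<pi> k" and A: "finite A" "A \<subseteq> K"
    and "(\<lambda>Fs. \<Sum>i\<in>A. scale (c i) (\<theta> i Fs)) \<in> poisson_coboundaries scale \<pi> k" and "i \<in> A"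
  shows "c i = 0"
proof -
  have "cohomology_class scale \<pi> k (\<lambda>Fs. \<Sum>i\<in>A. scale (c i) (\<theta> i Fs)) = cohomology_class scale \<pi> k (\<lambda>_. 0)"
    using assms(5) by (intro cohomology_class_cong) simp
  then have "(\<Oplus>\<^bsub>poisson_cohomology scale \<pi> k\<^esub>i\<in>A.
      c i \<odot>\<^bsub>poisson_cohomology scale \<pi> k\<^esub> cohomology_class scale \<pi> k (\<theta> i)) = \<zero>\<^bsub>poisson_cohomology scale \<pi> k\<^esub>"
    using A assms(2) finsum_poisson_cohomology [of A \<theta> c] cohomology_class_zero
    by (simp add: subset_iff) (simp add: poisson_cohomology_def)
  then show ?thesis
    using assms(1) A \<open>i \<in> A\<close> unfolding basis_family_def by (elim conjE allE [of _ A] allE [of _ c]) simp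
qed

lemma trivial_cohomologyD:
  assumes "carrier (poisson_cohomology scale \<pi> k) = {\<zero>\<^bsub>poisson_cohomology scale \<pi> k\<^esub>}"
    and "P \<in> poisson_cocycles scale \<pi> k"
  shows "P \<in> poisson_coboundaries scale \<pi> k"
proof -
  have "cohomology_class scale \<pi> k P = poisson_coboundaries scale \<pi> k"
    using assms by (auto simp: poisson_cohomology_def)
  then show ?thesis using cohomology_class_refl by metis
qed

end

end

section \<open>Poisson brackets on formal power series\<close>

context comm_algebra
begin

text \<open>A formal deformation seen only as a bracket on series: of its coefficients just the
  reduction modulo \<nu> is kept, and the lemmas on bilinear maps do the rest.\<close>

definition fps_poisson_bracket :: "('a list \<Rightarrow> 'a) \<Rightarrow> ('a fps list \<Rightarrow> 'a fps) \<Rightarrow> bool"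
  where "fps_poisson_bracket \<pi>\<^sub>0 \<pi> \<longleftrightarrow> fps_bilinear (\<lambda>F G. \<pi> [F, G]) \<and>
    (\<forall>F G. \<pi> [G, F] = - \<pi> [F, G]) \<and>
    (\<forall>F G H. \<pi> [F * G, H] = F * \<pi> [G, H] + G * \<pi> [F, H]) \<and> jacobi \<pi> \<and>
    (\<forall>f g. fps_nth (\<pi> [fps_const f, fps_const g]) 0 = \<pi>\<^sub>0 [f, g])"

lemma nu_series_nth:
  "fps_nth (nu_series \<pi>s [F, G]) n
    = (\<Sum>i\<le>n. \<Sum>j\<le>n - i. \<pi>s i [fps_nth F j, fps_nth G (n - i - j)])"
  by (simp add: nu_series_def fps_bilinear_ext_def)

context
  fixes \<pi>s :: "nat \<Rightarrow> 'a list \<Rightarrow> 'a"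
  assumes \<pi>s: "\<And>i. \<pi>s i \<in> multiderivations scale 2"
begin

lemma nu_series_const:
  "fps_nth (nu_series \<pi>s [fps_const f, fps_const g]) n = \<pi>s n [f, g]"
proof -
  have "fps_nth (nu_series \<pi>s [fps_const f, fps_const g]) n
      = (\<Sum>i\<le>n. \<Sum>j\<le>n - i. if j = 0 then (if i = n then \<pi>s n [f, g] else 0) else 0)"
    unfolding nu_series_nth
    by (intro sum.cong refl) (auto simp: multiderivations_2_0 [OF \<pi>s])
  then show ?thesis by simp
qed

lemma nu_series_skew: "nu_series \<pi>s [G, F] = - nu_series \<pi>s [F, G]"
proof (rule fps_ext)
  fix n
  have "(\<Sum>j\<le>m. \<pi>s i [fps_nth G j, fps_nth F (m - j)]) = - (\<Sum>j\<le>m. \<pi>s i [fps_nth F j, fps_nth G (m - j)])"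
    for i m
    unfolding sum_negf [symmetric]
    by (rule sum.reindex_bij_witness [of _ "\<lambda>j. m - j" "\<lambda>j. m - j"])
      (auto intro: multiderivations_2D(6) [OF \<pi>s, symmetric])
  then show "fps_nth (nu_series \<pi>s [G, F]) n = fps_nth (- nu_series \<pi>s [F, G]) n"
    by (simp add: nu_series_nth sum_negf del: diff_diff_left)
qed

lemma fps_bilinear_nu_series: "fps_bilinear (\<lambda>F G. nu_series \<pi>s [F, G])"
proof -
  note md = multiderivations_2D(1,2) [OF \<pi>s] multiderivations_2_0 [OF \<pi>s]
  have left: "fps_linear (\<lambda>F. nu_series \<pi>s [F, G])" for G
  proof (rule fps_linearI)
    fix F F' :: "'a fps" and c :: 'f
    show "nu_series \<pi>s [F + F', G] = nu_series \<pi>s [F, G] + nu_series \<pi>s [F', G]"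
      by (rule fps_ext) (simp add: nu_series_nth md sum.distrib)
    show "nu_series \<pi>s [fscale (fps_const c) F, G] = fscale (fps_const c) (nu_series \<pi>s [F, G])"
      by (rule fps_ext) (simp add: nu_series_nth md scale_sum_right)
    show "nu_series \<pi>s [fscale fps_X F, G] = fscale fps_X (nu_series \<pi>s [F, G])"
    proof (rule fps_ext)
      fix n
      show "fps_nth (nu_series \<pi>s [fscale fps_X F, G]) n = fps_nth (fscale fps_X (nu_series \<pi>s [F, G])) n"
      proof (cases n)
        case (Suc m)
        \<comment> \<open>The term \<open>j = 0\<close> drops because \<nu> times \<open>F\<close>
          has no constant term; for the same reason the outer term \<open>i = Suc m\<close> drops
          afterwards.\<close>
        have "(\<Sum>j\<le>Suc m - i. \<pi>s i [fps_nth (fscale fps_X F) j, fps_nth G (Suc m - i - j)])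
            = (\<Sum>j\<le>m - i. \<pi>s i [fps_nth F j, fps_nth G (m - i - j)])" if "i \<le> m" for i
          using that by (simp add: Suc_diff_le sum.atMost_Suc_shift md del: sum.atMost_Suc)
        then show ?thesis by (simp add: Suc nu_series_nth md)
      qed (simp add: nu_series_nth md)
    qed
  qed
  moreover have "fps_linear (\<lambda>G. nu_series \<pi>s [F, G])" for F
    using left [of F] nu_series_skew [of F]
    by (simp add: fps_linear_iff)
  ultimately show ?thesis by (simp add: fps_bilinear_def)
qed

text \<open>Both sides are linear over the scalar series in each argument. On constants the claim is
  the Leibniz rule of each coefficient; constants are then replaced by series one argument at a
  time.\<close>

lemma nu_series_leibniz:
  "nu_series \<pi>s [F * G, H] = F * nu_series \<pi>s [G, H] + G * nu_series \<pi>s [F, H]"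
proof -
  note B = fps_bilinearD [OF fps_bilinear_nu_series]
  note T = fps_bilinearD [OF fps_bilinear_times]
  note lin = fps_linear_add fps_linear_comp [OF B(1)] fps_linear_comp [OF T(1)] fps_linear_comp [OF T(2)]
    B T
  have 1: "nu_series \<pi>s [fps_const f * fps_const g, fps_const h]
      = fps_const f * nu_series \<pi>s [fps_const g, fps_const h]
        + fps_const g * nu_series \<pi>s [fps_const f, fps_const h]" for f g h
    by (rule fps_ext) (simp add: nu_series_const multiderivations_2D(3) [OF \<pi>s])
  have 2: "nu_series \<pi>s [fps_const f * fps_const g, H]
      = fps_const f * nu_series \<pi>s [fps_const g, H] + fps_const g * nu_series \<pi>s [fps_const f, H]" for f g H
    by (rule fps_linear_eqI [of "\<lambda>H. nu_series \<pi>s [fps_const f * fps_const g, H]" "\<lambda>H. fps_const f * nu_series \<pi>s [fps_const g, H] + fps_const g * nu_series \<pi>s [fps_const f, H]" H, OF _ _ 1]) (intro lin)+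
  have 3: "nu_series \<pi>s [fps_const f * G, H]
      = fps_const f * nu_series \<pi>s [G, H] + G * nu_series \<pi>s [fps_const f, H]" for f G H
    by (rule fps_linear_eqI [of "\<lambda>G. nu_series \<pi>s [fps_const f * G, H]" "\<lambda>G. fps_const f * nu_series \<pi>s [G, H] + G * nu_series \<pi>s [fps_const f, H]" G, OF _ _ 2]) (intro lin)+
  show ?thesis
    by (rule fps_linear_eqI [of "\<lambda>F. nu_series \<pi>s [F * G, H]" "\<lambda>F. F * nu_series \<pi>s [G, H] + G * nu_series \<pi>s [F, H]" F, OF _ _ 3]) (intro lin)+
qed

lemma fps_poisson_bracket_nu_series:
  "jacobi (nu_series \<pi>s) \<Longrightarrow> fps_poisson_bracket (\<pi>s 0) (nu_series \<pi>s)"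
  by (simp add: fps_poisson_bracket_def fps_bilinear_nu_series nu_series_skew [symmetric]
      nu_series_leibniz nu_series_const)

end

lemma formal_deformation_imp_bracket:
  "formal_deformation scale \<pi>\<^sub>0 \<pi> \<Longrightarrow> fps_poisson_bracket \<pi>\<^sub>0 \<pi>"
  using fps_poisson_bracket_nu_series by (auto simp: formal_deformation_def)

section \<open>Derivations and morphisms of the algebra of series\<close>

definition coefficientwise :: "('a list \<Rightarrow> 'a) \<Rightarrow> 'a fps \<Rightarrow> 'a fps"
  where "coefficientwise V F = Abs_fps (\<lambda>m. V [fps_nth F m])"

lemma fps_linear_coefficientwise:
  assumes "V \<in> multiderivations scale 1"
  shows "fps_linear (coefficientwise V)"
proof -
  note V = multiderivations_1D [OF assms]
  have "V [0] = 0" using V(2) [of 0 0] by simp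
  then show ?thesis
    by (intro fps_linearI) (auto simp: coefficientwise_def V intro!: fps_ext)
qed

lemma coefficientwise_mult:
  assumes "V \<in> multiderivations scale 1"
  shows "coefficientwise V (F * G) = coefficientwise V F * G + F * coefficientwise V G"
proof (rule fps_ext)
  fix n
  note V = multiderivations_1D [OF assms]
  have "V [0] = 0" using V(2) [of 0 0] by simp
  then have "V [sum f A] = (\<Sum>x\<in>A. V [f x])" for f :: "nat \<Rightarrow> 'a" and A
    by (induction A rule: infinite_finite_induct) (simp_all add: V)
  moreover have "V [x * y] = V [x] * y + x * V [y]" for x y
    by (simp add: V(3) mult.commute add.commute)
  ultimately show "fps_nth (coefficientwise V (F * G)) n = fps_nth (coefficientwise V F * G + F * coefficientwise V G) n"
    by (simp add: coefficientwise_def fps_mult_nth sum.distrib)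
qed

text \<open>The conditions on the map in \<open>equivalent_deformations\<close> that do not involve
  the brackets.\<close>

definition fps_algebra_morphism :: "('a fps \<Rightarrow> 'a fps) \<Rightarrow> bool"
  where "fps_algebra_morphism \<Phi> \<longleftrightarrow> fps_linear \<Phi> \<and> (\<forall>F G. \<Phi> (F * G) = \<Phi> F * \<Phi> G) \<and>
    (\<forall>F. fps_nth (\<Phi> F) 0 = fps_nth F 0)"

text \<open>Multiplying by \<nu>^s keeps \<open>L\<close> a derivation, so its exponential is
  multiplicative by \<open>fps_exp_map_bilinear\<close> for the product, and
  \<open>1 \<le> s\<close> makes it the identity modulo \<nu>.\<close>

lemma fps_algebra_morphism_exp_comp:
  assumes \<Phi>: "fps_algebra_morphism \<Phi>"
    and L: "fps_linear L" "\<And>F G. L (F * G) = L F * G + F * L G" and s: "1 \<le> s"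
  shows "fps_algebra_morphism (\<lambda>F. fps_exp_map (\<lambda>F. fscale (fps_X ^ s) (L F)) (\<Phi> F))"
proof -
  let ?D = "\<lambda>F. fscale (fps_X ^ s) (L F)"
  have D: "fps_linear ?D" "\<And>F. fps_nth (?D F) 0 = 0"
    using s by (simp_all add: L fps_linear_fscale)
  have "?D (F * G) = ?D F * G + F * ?D G" for F G
    by (simp add: L fps.scale_right_distrib fscale_mult_left fps_bilinear_right [OF fps_bilinear_times])
  from fps_exp_map_bilinear [OF D fps_bilinear_times this]
  show ?thesis
    using \<Phi> s fps_linear_comp [OF fps_linear_exp_map [OF D]] fps_exp_map_X_power_nth [OF L(1) s]
    by (simp add: fps_algebra_morphism_def)
qed

end

section \<open>Intertwining errors\<close>

context comm_algebra
begin

lemma fps_poisson_bracketD: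
  assumes "fps_poisson_bracket \<pi>\<^sub>0 \<pi>"
  shows "fps_bilinear (\<lambda>F G. \<pi> [F, G])" "\<pi> [G, F] = - \<pi> [F, G]"
    "\<pi> [F * G, H] = F * \<pi> [G, H] + G * \<pi> [F, H]"
    "\<pi> [\<pi> [F, G], H] + \<pi> [\<pi> [G, H], F] + \<pi> [\<pi> [H, F], G] = 0"
    "fps_nth (\<pi> [F, G]) 0 = \<pi>\<^sub>0 [fps_nth F 0, fps_nth G 0]"
proof -
  show B: "fps_bilinear (\<lambda>F G. \<pi> [F, G])" and "\<pi> [G, F] = - \<pi> [F, G]"
    and "\<pi> [F * G, H] = F * \<pi> [G, H] + G * \<pi> [F, H]"
    and "\<pi> [\<pi> [F, G], H] + \<pi> [\<pi> [G, H], F] + \<pi> [\<pi> [H, F], G] = 0"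
    using assms unfolding fps_poisson_bracket_def jacobi_def by blast+
  show "fps_nth (\<pi> [F, G]) 0 = \<pi>\<^sub>0 [fps_nth F 0, fps_nth G 0]"
    unfolding fps_bilinear_nth_const [OF B, of 0 F G, simplified]
    using assms unfolding fps_poisson_bracket_def by blast
qed

lemma fps_algebra_morphismD:
  assumes "fps_algebra_morphism \<Phi>"
  shows "fps_linear \<Phi>" "\<Phi> (F * G) = \<Phi> F * \<Phi> G" "fps_nth (\<Phi> F) 0 = fps_nth F 0"
  using assms by (simp_all add: fps_algebra_morphism_def)

lemma fps_const_scale: "fps_const (scale c x) = fscale (fps_const c) (fps_const x)"
  by (rule fps_ext) simp

text \<open>Split \<open>\<pi> [F, G]\<close> into \<open>\<pi> [F', G']\<close>,
  \<open>\<pi> [F - F', G]\<close> and \<open>\<pi> [F', G - G']\<close>; at order \<open>n\<close>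
  the last two see only leading coefficients, through \<open>\<pi>\<^sub>0\<close>.\<close>

lemma fps_bracket_perturbation:
  assumes \<pi>: "fps_poisson_bracket \<pi>\<^sub>0 \<pi>"
    and F: "\<forall>i<n. fps_nth F i = fps_nth F' i" and G: "\<forall>i<n. fps_nth G i = fps_nth G' i"
  shows "fps_nth (\<pi> [F, G]) n = fps_nth (\<pi> [F', G']) n
    + \<pi>\<^sub>0 [fps_nth F n - fps_nth F' n, fps_nth G 0] + \<pi>\<^sub>0 [fps_nth F' 0, fps_nth G n - fps_nth G' n]"
proof -
  note B = fps_poisson_bracketD(1) [OF \<pi>]
  have "\<pi> [F, G] = \<pi> [F', G'] + \<pi> [F - F', G] + \<pi> [F', G - G']"
    by (simp add: fps_bilinear_left(2) [OF B] fps_bilinear_right(2) [OF B])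
  then show ?thesis
    using fps_bilinear_nth_lead_left [OF B, of n "F - F'" G] F
      fps_bilinear_nth_lead_right [OF B, of n "G - G'" F'] G
    by (simp add: fps_poisson_bracketD(5) [OF \<pi>])
qed

lemma fps_times_nth_lead:
  fixes F G :: "'a fps"
  assumes "\<forall>i<n. fps_nth G i = 0"
  shows "fps_nth (F * G) n = fps_nth F 0 * fps_nth G n" "fps_nth (G * F) n = fps_nth G n * fps_nth F 0"
  using fps_bilinear_nth_lead_right [OF fps_bilinear_times assms]
    fps_bilinear_nth_lead_left [OF fps_bilinear_times assms] by simp_all

definition intertwining_error ::
    "('a fps list \<Rightarrow> 'a fps) \<Rightarrow> ('a fps list \<Rightarrow> 'a fps) \<Rightarrow> ('a fps \<Rightarrow> 'a fps) \<Rightarrow> 'a fps \<Rightarrow> 'a fps \<Rightarrow> 'a fps"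
  where "intertwining_error \<pi> \<pi>' \<Phi> F G = \<Phi> (\<pi> [F, G]) - \<pi>' [\<Phi> F, \<Phi> G]"

lemma fps_bilinear_intertwining_error:
  assumes "fps_poisson_bracket \<pi>\<^sub>0 \<pi>" "fps_poisson_bracket \<pi>\<^sub>0 \<pi>'" "fps_algebra_morphism \<Phi>"
  shows "fps_bilinear (intertwining_error \<pi> \<pi>' \<Phi>)"
proof -
  note \<Phi> = fps_algebra_morphismD(1) [OF assms(3)]
  have "intertwining_error \<pi> \<pi>' \<Phi> = (\<lambda>F G. \<Phi> (\<pi> [F, G]) - \<pi>' [\<Phi> F, \<Phi> G])"
    by (simp add: fun_eq_iff intertwining_error_def)
  with fps_bilinear_diff [OF
      fps_bilinear_compose_left [OF fps_poisson_bracketD(1) [OF assms(1)] \<Phi>]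
      fps_bilinear_compose [OF fps_poisson_bracketD(1) [OF assms(2)] \<Phi> \<Phi>]]
  show ?thesis by simp
qed

text \<open>The cocycle identity comes from applying \<open>\<Phi>\<close> to the Jacobi identity of \<open>\<pi>\<close> and replacing \<open>\<pi>\<close>
  by \<open>\<pi>'\<close> twice: the Jacobi identity of \<open>\<pi>'\<close> cancels the terms without the error.\<close>

lemma intertwining_error_cocycle:
  assumes \<pi>: "fps_poisson_bracket \<pi>\<^sub>0 \<pi>" and \<pi>': "fps_poisson_bracket \<pi>\<^sub>0 \<pi>'"
    and \<Phi>: "fps_algebra_morphism \<Phi>" and \<pi>\<^sub>0: "\<pi>\<^sub>0 \<in> multiderivations scale 2"
  defines "E \<equiv> intertwining_error \<pi> \<pi>' \<Phi>"
  assumes low: "\<And>F G i. i < n \<Longrightarrow> fps_nth (E F G) i = 0"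
  obtains e where "e \<in> poisson_cocycles scale \<pi>\<^sub>0 2"
    "\<And>F G. fps_nth (E F G) n = e [fps_nth F 0, fps_nth G 0]"
proof
  have E: "fps_bilinear E"
    unfolding E_def by (rule fps_bilinear_intertwining_error [OF \<pi> \<pi>' \<Phi>])
  note \<Phi>_lin = fps_linearD [OF fps_algebra_morphismD(1) [OF \<Phi>]]
  note B' = fps_poisson_bracketD(1) [OF \<pi>']
  \<comment> \<open>\<open>E\<close> starts at order \<open>n\<close>, so its coefficient there
    depends on constant terms alone; \<open>p\<close> records it and \<open>e\<close> puts it in
    list form.\<close>
  define p where "p x y = fps_nth (E (fps_const x) (fps_const y)) n" for x y
  define e where "e Fs = (if length Fs = 2 then p (Fs ! 0) (Fs ! 1) else 0)" for Fs
  show e: "fps_nth (E F G) n = e [fps_nth F 0, fps_nth G 0]" for F G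
    using fps_bilinear_nth_const [OF E low, where F = F and G = G] by (simp add: e_def p_def)
  have e_md: "e \<in> multiderivations scale 2"
    unfolding e_def
  proof (rule multiderivations_2I)
    fix x y z :: 'a and c :: 'f
    show "p (x + y) z = p x z + p y z"
      by (simp add: p_def fps_bilinear_left [OF E] flip: fps_const_add)
    show "p (scale c x) z = scale c (p x z)"
      by (simp add: p_def fps_const_scale fps_bilinear_left [OF E])
    have "E F G = - E G F" for F G
      using fps_poisson_bracketD(2) [OF \<pi>, of F G] fps_poisson_bracketD(2) [OF \<pi>', of "\<Phi> F" "\<Phi> G"]
      by (simp add: E_def intertwining_error_def \<Phi>_lin)
    then show "p y x = - p x y"
      unfolding p_def by (metis fps_neg_nth)
    \<comment> \<open>A Leibniz rule along \<Phi>. At order \<open>n\<close> the factors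
      \<open>\<Phi> F\<close> and \<open>\<Phi> G\<close> enter by their constant terms, which are
      those of \<open>F\<close> and \<open>G\<close>.\<close>
    have "E (F * G) H = \<Phi> F * E G H + \<Phi> G * E F H" for F G H
      by (simp add: E_def intertwining_error_def fps_poisson_bracketD(3) [OF \<pi>]
          fps_poisson_bracketD(3) [OF \<pi>'] fps_algebra_morphismD(2) [OF \<Phi>] \<Phi>_lin algebra_simps)
    then show "p (x * y) z = x * p y z + y * p x z"
      using low by (simp add: p_def fps_times_nth_lead fps_algebra_morphismD(3) [OF \<Phi>]
          flip: fps_const_mult)
  qed
  have "poisson_delta scale \<pi>\<^sub>0 2 e Fs = 0" for Fs
  proof (cases "length Fs = 3")
    case True
    then obtain x y z where Fs: "Fs = [x, y, z]"
      by (auto simp: length_Suc_conv numeral_3_eq_3)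
    have split: "\<Phi> (\<pi> [\<pi> [X, Y], Z]) = E (\<pi> [X, Y]) Z + \<pi>' [E X Y, \<Phi> Z] + \<pi>' [\<pi>' [\<Phi> X, \<Phi> Y], \<Phi> Z]"
      for X Y Z
      by (simp add: E_def intertwining_error_def fps_bilinear_left(2) [OF B'])
    have "0 = \<Phi> (\<pi> [\<pi> [X, Y], Z] + \<pi> [\<pi> [Y, Z], X] + \<pi> [\<pi> [Z, X], Y])" for X Y Z
      by (simp add: fps_poisson_bracketD(4) [OF \<pi>] \<Phi>_lin)
    also have "\<dots> X Y Z = E (\<pi> [X, Y]) Z + \<pi>' [E X Y, \<Phi> Z] + (E (\<pi> [Y, Z]) X + \<pi>' [E Y Z, \<Phi> X])
        + (E (\<pi> [Z, X]) Y + \<pi>' [E Z X, \<Phi> Y])" for X Y Z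
      using fps_poisson_bracketD(4) [OF \<pi>', of "\<Phi> X" "\<Phi> Y" "\<Phi> Z"]
      by (simp add: \<Phi>_lin split algebra_simps)
    finally have sum: "0 = E (\<pi> [X, Y]) Z + \<pi>' [E X Y, \<Phi> Z] + (E (\<pi> [Y, Z]) X + \<pi>' [E Y Z, \<Phi> X])
        + (E (\<pi> [Z, X]) Y + \<pi>' [E Z X, \<Phi> Y])" for X Y Z .
    \<comment> \<open>As \<open>E\<close> starts at order \<open>n\<close>, every bracket combined
      with it contributes only its reduction \<open>\<pi>\<^sub>0\<close>.\<close>
    have lead: "fps_nth (E (\<pi> [fps_const u, fps_const v]) (fps_const w)) n = e [\<pi>\<^sub>0 [u, v], w]"
      "fps_nth (\<pi>' [E (fps_const u) (fps_const v), \<Phi> (fps_const w)]) n = \<pi>\<^sub>0 [e [u, v], w]" for u v w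
      using fps_bilinear_nth_lead_left [OF B', of n "E (fps_const u) (fps_const v)"] low
      by (simp_all add: e fps_poisson_bracketD(5) [OF \<pi>] fps_poisson_bracketD(5) [OF \<pi>']
          fps_algebra_morphismD(3) [OF \<Phi>])
    have "0 = e [\<pi>\<^sub>0 [x, y], z] + \<pi>\<^sub>0 [e [x, y], z] + (e [\<pi>\<^sub>0 [y, z], x] + \<pi>\<^sub>0 [e [y, z], x])
        + (e [\<pi>\<^sub>0 [z, x], y] + \<pi>\<^sub>0 [e [z, x], y])"
      using arg_cong [OF sum [of "fps_const x" "fps_const y" "fps_const z"], of "\<lambda>F. fps_nth F n"]
      by (simp add: lead)
    \<comment> \<open>The cyclic sum has \<open>z, x\<close> where \<open>poisson_delta_2\<close>
      has \<open>x, z\<close>; skew-symmetry accounts for the signs.\<close>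
    moreover have "e [\<pi>\<^sub>0 [x, z], y] = - e [\<pi>\<^sub>0 [z, x], y]" "\<pi>\<^sub>0 [e [x, z], y] = - \<pi>\<^sub>0 [e [z, x], y]"
      using multiderivations_2D(6) [of _ x z] multiderivations_2_neg e_md \<pi>\<^sub>0 by metis+
    ultimately show ?thesis
      by (simp add: Fs poisson_delta_2 algebra_simps)
  qed (simp add: poisson_delta_length)
  with e_md show "e \<in> poisson_cocycles scale \<pi>\<^sub>0 2"
    by (simp add: poisson_cocycles_def fun_eq_iff)
qed

end

section \<open>Families of deformations\<close>

locale poisson_deformation_family = comm_algebra scale
  for scale :: "'f::field_char_0 \<Rightarrow> 'a::comm_ring \<Rightarrow> 'a" +
  fixes \<pi>\<^sub>0 :: "'a list \<Rightarrow> 'a"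
    and K :: "'k set"
    and \<theta> :: "'k \<Rightarrow> 'a list \<Rightarrow> 'a"
    and \<Psi> :: "(nat \<Rightarrow> 'k \<Rightarrow> 'f) \<Rightarrow> nat \<Rightarrow> 'a list \<Rightarrow> 'a"
  assumes \<pi>\<^sub>0: "\<pi>\<^sub>0 \<in> multiderivations scale 2"
    and \<theta>: "\<forall>k\<in>K. \<theta> k \<in> poisson_cocycles scale \<pi>\<^sub>0 2"
    and basis: "basis_family (poisson_cohomology scale \<pi>\<^sub>0 2) K (\<lambda>k. cohomology_class scale \<pi>\<^sub>0 2 (\<theta> k))"
    and \<Psi>: "a \<in> coefficient_families K \<Longrightarrow> 1 \<le> n \<Longrightarrow> \<Psi> a n \<in> multiderivations scale 2"
    and \<Psi>_cong: "1 \<le> n \<Longrightarrow> a \<in> coefficient_families K \<Longrightarrow> b \<in> coefficient_families K \<Longrightarrow>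
      (\<And>k m. k \<in> K \<Longrightarrow> 1 \<le> m \<Longrightarrow> m \<le> n - 1 \<Longrightarrow> a m k = b m k) \<Longrightarrow> \<Psi> a n = \<Psi> b n"
    and formal_deformation: "a \<in> coefficient_families K \<Longrightarrow>
      formal_deformation scale \<pi>\<^sub>0 (deformation_family scale \<pi>\<^sub>0 K \<theta> (\<Psi> a) a)"
begin

abbreviation deformation :: "(nat \<Rightarrow> 'k \<Rightarrow> 'f) \<Rightarrow> 'a fps list \<Rightarrow> 'a fps"
  where "deformation a \<equiv> deformation_family scale \<pi>\<^sub>0 K \<theta> (\<Psi> a) a"

lemma bracket_deformation: "a \<in> coefficient_families K \<Longrightarrow> fps_poisson_bracket \<pi>\<^sub>0 (deformation a)"
  by (rule formal_deformation_imp_bracket [OF formal_deformation])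

lemma coefficient_families_support_finite: "a \<in> coefficient_families K \<Longrightarrow> finite {k \<in> K. a n k \<noteq> 0}"
  by (cases "n = 0") (auto simp: coefficient_families_def)

lemma coefficient_families_eq_0: "a \<in> coefficient_families K \<Longrightarrow> n = 0 \<or> k \<notin> K \<Longrightarrow> a n k = 0"
  by (auto simp: coefficient_families_def)

lemma \<theta>_multiderivation: "k \<in> K \<Longrightarrow> \<theta> k \<in> multiderivations scale 2"
  using \<theta> by (simp add: poisson_cocycles_def)

text \<open>The set \<open>A\<close> may exceed the support, so that two families can be compared
  over one finite index set.\<close>

lemma deformation_const_nth:
  assumes a: "a \<in> coefficient_families K" and "1 \<le> n"
    and A: "finite A" "A \<subseteq> K" "{k \<in> K. a n k \<noteq> 0} \<subseteq> A"
  shows "fps_nth (deformation a [fps_const f, fps_const g]) n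
    = \<Psi> a n [f, g] + (\<Sum>k\<in>A. scale (a n k) (\<theta> k [f, g]))"
proof -
  note sub = pointwise_subspace_multiderivations [of 2]
  have "(\<lambda>Fs. \<Psi> a i Fs + (\<Sum>k\<in>{k \<in> K. a i k \<noteq> 0}. scale (a i k) (\<theta> k Fs))) \<in> multiderivations scale 2"
    if "i \<noteq> 0" for i
    using that a by (intro pointwise_subspaceD(2) [OF sub] pointwise_subspace_sum [OF sub] \<Psi> \<theta>_multiderivation) auto
  then have "(if i = 0 then \<pi>\<^sub>0 else (\<lambda>Fs. \<Psi> a i Fs
      + (\<Sum>k\<in>{k \<in> K. a i k \<noteq> 0}. scale (a i k) (\<theta> k Fs)))) \<in> multiderivations scale 2" for i
    using \<pi>\<^sub>0 by simp
  from nu_series_const [OF this]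
  have "fps_nth (deformation a [fps_const f, fps_const g]) n
      = \<Psi> a n [f, g] + (\<Sum>k\<in>{k \<in> K. a n k \<noteq> 0}. scale (a n k) (\<theta> k [f, g]))"
    using \<open>1 \<le> n\<close> by (simp add: deformation_family_def)
  also have "(\<Sum>k\<in>{k \<in> K. a n k \<noteq> 0}. scale (a n k) (\<theta> k [f, g])) = (\<Sum>k\<in>A. scale (a n k) (\<theta> k [f, g]))"
    using A by (intro sum.mono_neutral_left) auto
  finally show ?thesis .
qed

text \<open>The difference of the two brackets is bilinear, so it suffices to compare them on
  constants, where the coefficients are explicit.\<close>

lemma
  assumes a: "a \<in> coefficient_families K" and b: "b \<in> coefficient_families K"
    and agree: "\<And>m. m < n \<Longrightarrow> a m = b m"
  shows deformation_nth_cong: "i < n \<Longrightarrow> fps_nth (deformation a [F, G]) i = fps_nth (deformation b [F, G]) i"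
    and deformation_nth_diff: "1 \<le> n \<Longrightarrow> finite A \<Longrightarrow> A \<subseteq> K \<Longrightarrow> {k \<in> K. a n k \<noteq> 0} \<subseteq> A \<Longrightarrow>
      {k \<in> K. b n k \<noteq> 0} \<subseteq> A \<Longrightarrow> fps_nth (deformation a [F, G]) n = fps_nth (deformation b [F, G]) n
        + (\<Sum>k\<in>A. scale (a n k - b n k) (\<theta> k [fps_nth F 0, fps_nth G 0]))"
proof -
  note Ba = fps_poisson_bracketD [OF bracket_deformation [OF a]]
    and Bb = fps_poisson_bracketD [OF bracket_deformation [OF b]]
  note B = fps_bilinear_diff [OF Ba(1) Bb(1)]
  \<comment> \<open>Order \<open>n\<close> is included: \<open>\<Psi> a n\<close> depends on
    parameters of index at most \<open>n - 1\<close>, where \<open>a\<close> and \<open>b\<close>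
    agree.\<close>
  have \<Psi>_eq: "\<Psi> a i = \<Psi> b i" if "i \<le> n" "1 \<le> i" for i
    using that by (intro \<Psi>_cong a b) (auto simp: agree)
  have const: "fps_nth (deformation a [fps_const f, fps_const g] - deformation b [fps_const f, fps_const g]) i = 0"
    if "i < n" for i f g
  proof (cases "i = 0")
    case False
    then show ?thesis
      using that deformation_const_nth [OF a, of i "{k \<in> K. a i k \<noteq> 0}"]
        deformation_const_nth [OF b, of i "{k \<in> K. a i k \<noteq> 0}"]
        coefficient_families_support_finite [OF a, of i] agree [OF that] \<Psi>_eq [of i]
      by simp
  qed (simp add: Ba(5) Bb(5))
  then have low: "fps_nth (deformation a [F, G] - deformation b [F, G]) i = 0" if "i < n" for F G i
    using fps_bilinear_const_nth_eq_0 [OF B, of n i F G] that by simp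
  then show "i < n \<Longrightarrow> fps_nth (deformation a [F, G]) i = fps_nth (deformation b [F, G]) i"
    by simp
  assume A: "1 \<le> n" "finite A" "A \<subseteq> K" "{k \<in> K. a n k \<noteq> 0} \<subseteq> A" "{k \<in> K. b n k \<noteq> 0} \<subseteq> A"
  have "fps_nth (deformation a [F, G] - deformation b [F, G]) n = fps_nth (deformation a
      [fps_const (fps_nth F 0), fps_const (fps_nth G 0)] - deformation b
      [fps_const (fps_nth F 0), fps_const (fps_nth G 0)]) n"
    using fps_bilinear_nth_const [OF B, of n F G] low by blast
  also have "\<dots> = (\<Sum>k\<in>A. scale (a n k - b n k) (\<theta> k [fps_nth F 0, fps_nth G 0]))"
    using A by (simp add: deformation_const_nth [OF a A(1-4)] deformation_const_nth [OF b A(1-3,5)] \<Psi>_eq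
        scale_left_diff_distrib sum_subtractf)
  finally show "fps_nth (deformation a [F, G]) n = fps_nth (deformation b [F, G]) n
        + (\<Sum>k\<in>A. scale (a n k - b n k) (\<theta> k [fps_nth F 0, fps_nth G 0]))"
    by (simp add: algebra_simps)
qed

section \<open>Existence of an equivalent member of the family\<close>

text \<open>One order of the construction. Adding \<open>c\<close> to \<open>a n\<close> subtracts
  the combination of the \<open>\<theta> k\<close> from the error at order \<open>n\<close>, and the
  exponential of \<nu>^n \<open>V\<close> subtracts the coboundary of \<open>V\<close>; nothing
  changes below.\<close>

lemma extend_equivalence:
  assumes \<pi>: "fps_poisson_bracket \<pi>\<^sub>0 \<pi>" and a: "a \<in> coefficient_families K"
    and \<Phi>: "fps_algebra_morphism \<Phi>" and n: "1 \<le> n"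
    and low: "\<And>F G i. i < n \<Longrightarrow> fps_nth (intertwining_error \<pi> (deformation a) \<Phi> F G) i = 0"
  obtains a' \<Phi>' where "a' \<in> coefficient_families K" "fps_algebra_morphism \<Phi>'"
    "\<And>m. m < n \<Longrightarrow> a' m = a m" "\<And>F i. i < n \<Longrightarrow> fps_nth (\<Phi>' F) i = fps_nth (\<Phi> F) i"
    "\<And>F G i. i < Suc n \<Longrightarrow> fps_nth (intertwining_error \<pi> (deformation a') \<Phi>' F G) i = 0"
proof -
  obtain e where e: "e \<in> poisson_cocycles scale \<pi>\<^sub>0 2"
    and e_nth: "\<And>F G. fps_nth (intertwining_error \<pi> (deformation a) \<Phi> F G) n = e [fps_nth F 0, fps_nth G 0]"
    using intertwining_error_cocycle [OF \<pi> bracket_deformation [OF a] \<Phi> \<pi>\<^sub>0 low] by blast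
  obtain A c where A: "finite A" "A \<subseteq> K"
    and "(\<lambda>Fs. e Fs - (\<Sum>k\<in>A. scale (c k) (\<theta> k Fs))) \<in> poisson_coboundaries scale \<pi>\<^sub>0 2"
    by (rule basis_family_spans [OF \<pi>\<^sub>0 basis \<theta> e])
  then obtain V where V: "V \<in> multiderivations scale 1"
    and eV: "(\<lambda>Fs. e Fs - (\<Sum>k\<in>A. scale (c k) (\<theta> k Fs))) = poisson_delta scale \<pi>\<^sub>0 1 V"
    by (auto simp: poisson_coboundaries_def)
  have e_eq: "e [f, g] = (\<Sum>k\<in>A. scale (c k) (\<theta> k [f, g])) + \<pi>\<^sub>0 [V [f], g] + \<pi>\<^sub>0 [f, V [g]] - V [\<pi>\<^sub>0 [f, g]]"
    for f g
    using fun_cong [OF eV, of "[f, g]"] multiderivations_2D(6) [OF \<pi>\<^sub>0, of f "V [g]"]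
    by (simp add: poisson_delta_1 [simplified] algebra_simps)
  define a' where "a' m k = (if m = n \<and> k \<in> A then a n k + c k else a m k)" for m k
  define \<Phi>' where "\<Phi>' F = fps_exp_map (\<lambda>F. fscale (fps_X ^ n) (coefficientwise V F)) (\<Phi> F)" for F
  have a': "a' \<in> coefficient_families K"
  proof -
    have "{k \<in> K. a' m k \<noteq> 0} \<subseteq> {k \<in> K. a m k \<noteq> 0} \<union> A" for m
      by (auto simp: a'_def split: if_splits)
    then have "finite {k \<in> K. a' m k \<noteq> 0}" for m
      using coefficient_families_support_finite [OF a] A(1) by (meson finite_UnI finite_subset)
    moreover have "a' m k = 0" if "m = 0 \<or> k \<notin> K" for m k
      using that n A(2) coefficient_families_eq_0 [OF a] by (auto simp: a'_def)
    ultimately show ?thesis by (simp add: coefficient_families_def)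
  qed
  have \<Phi>': "fps_algebra_morphism \<Phi>'"
    unfolding \<Phi>'_def
    by (rule fps_algebra_morphism_exp_comp [OF \<Phi> fps_linear_coefficientwise [OF V] coefficientwise_mult [OF V] n])
  have agree: "a' m = a m" if "m < n" for m
    using that by (auto simp: a'_def fun_eq_iff)
  have \<Phi>'_nth: "fps_nth (\<Phi>' F) i = fps_nth (\<Phi> F) i + (if i = n then V [fps_nth F 0] else 0)"
    if "i \<le> n" for F i
    using fps_exp_map_X_power_nth [OF fps_linear_coefficientwise [OF V] n that]
    by (simp add: \<Phi>'_def coefficientwise_def fps_algebra_morphismD(3) [OF \<Phi>])
  have "fps_nth (intertwining_error \<pi> (deformation a') \<Phi>' F G) i = 0" if "i < Suc n" for F G i
  proof (cases "i = n")
    case False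
    with that have i: "i < n" by simp
    have "fps_nth (deformation a' [\<Phi>' F, \<Phi>' G]) i = fps_nth (deformation a [\<Phi>' F, \<Phi>' G]) i"
      by (rule deformation_nth_cong [OF a' a agree i])
    also have "\<dots> = fps_nth (deformation a [\<Phi> F, \<Phi> G]) i"
      by (rule fps_bilinear_nth_cong [OF fps_poisson_bracketD(1) [OF bracket_deformation [OF a]] _ _ i])
        (auto simp: \<Phi>'_nth)
    finally show ?thesis
      using low [OF i, of F G] i by (simp add: intertwining_error_def \<Phi>'_nth)
  next
    case True
    \<comment> \<open>This set contains both supports at order \<open>n\<close>. Outside
      \<open>A\<close> the two families agree, so the sum shrinks to \<open>A\<close>
      afterwards.\<close>
    let ?A = "A \<union> {k \<in> K. a n k \<noteq> 0}"
    have "fps_nth (deformation a' [\<Phi>' F, \<Phi>' G]) n = fps_nth (deformation a [\<Phi>' F, \<Phi>' G]) n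
        + (\<Sum>k\<in>?A. scale (a' n k - a n k) (\<theta> k [fps_nth (\<Phi>' F) 0, fps_nth (\<Phi>' G) 0]))"
      using A coefficient_families_support_finite [OF a]
      by (intro deformation_nth_diff [OF a' a agree n]) (auto simp: a'_def)
    also have "fps_nth (deformation a [\<Phi>' F, \<Phi>' G]) n = fps_nth (deformation a [\<Phi> F, \<Phi> G]) n
        + \<pi>\<^sub>0 [V [fps_nth F 0], fps_nth G 0] + \<pi>\<^sub>0 [fps_nth F 0, V [fps_nth G 0]]"
      using fps_bracket_perturbation [OF bracket_deformation [OF a], of n "\<Phi>' F" "\<Phi> F" "\<Phi>' G" "\<Phi> G"]
      by (simp add: \<Phi>'_nth fps_algebra_morphismD(3) [OF \<Phi>] fps_algebra_morphismD(3) [OF \<Phi>'])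
    also have "(\<Sum>k\<in>?A. scale (a' n k - a n k) (\<theta> k [fps_nth (\<Phi>' F) 0, fps_nth (\<Phi>' G) 0]))
        = (\<Sum>k\<in>?A. scale (a' n k - a n k) (\<theta> k [fps_nth F 0, fps_nth G 0]))"
      by (simp add: fps_algebra_morphismD(3) [OF \<Phi>'])
    also have "\<dots> = (\<Sum>k\<in>A. scale (c k) (\<theta> k [fps_nth F 0, fps_nth G 0]))"
      using A coefficient_families_support_finite [OF a]
      by (intro sum.mono_neutral_cong_right) (auto simp: a'_def)
    finally show ?thesis
      using e_nth [of F G] True e_eq [of "fps_nth F 0" "fps_nth G 0"]
      by (simp add: intertwining_error_def \<Phi>'_nth fps_poisson_bracketD(5) [OF \<pi>] algebra_simps)
  qed
  with a' \<Phi>' agree \<Phi>'_nth show thesis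
    using that by simp
qed

lemma equivalent_deformations_iff:
  "equivalent_deformations scale \<pi> \<pi>' \<longleftrightarrow>
    (\<exists>\<Phi>. fps_algebra_morphism \<Phi> \<and> (\<forall>F G. \<Phi> (\<pi> [F, G]) = \<pi>' [\<Phi> F, \<Phi> G]))"
  by (auto simp: equivalent_deformations_def fps_algebra_morphism_def)

text \<open>Dependent choice iterates \<open>extend_equivalence\<close>. Since the passage from
  \<open>n\<close> to \<open>Suc n\<close> changes nothing through order \<open>n\<close>, diagonal
  sequences give the limits of parameters and morphisms.\<close>

lemma exists_equivalent:
  assumes \<pi>: "fps_poisson_bracket \<pi>\<^sub>0 \<pi>"
  shows "\<exists>a\<in>coefficient_families K. equivalent_deformations scale \<pi> (deformation a)"
proof -
  \<comment> \<open>\<open>P n\<close> asks for intertwining through order \<open>n\<close>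
    inclusive, and \<open>Q n\<close> freezes parameters and morphism through order
    \<open>n\<close>.\<close>
  define P where "P n = (\<lambda>(a, \<Phi>). a \<in> coefficient_families K \<and> fps_algebra_morphism \<Phi> \<and>
    (\<forall>F G. \<forall>i<Suc n. fps_nth (intertwining_error \<pi> (deformation a) \<Phi> F G) i = 0))" for n
  define Q where "Q n = (\<lambda>(a :: nat \<Rightarrow> 'k \<Rightarrow> 'f, \<Phi> :: 'a fps \<Rightarrow> 'a fps) (a', \<Phi>').
    (\<forall>m\<le>n. a' m = a m) \<and> (\<forall>F. \<forall>i\<le>n. fps_nth (\<Phi>' F) i = fps_nth (\<Phi> F) i))" for n :: nat
  have "(\<lambda>_ _. 0) \<in> coefficient_families K"
    by (simp add: coefficient_families_def)
  from fps_poisson_bracketD(5) [OF bracket_deformation [OF this]]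
  \<comment> \<open>The start is the zero family with the identity: at order 0 both brackets reduce
    to \<open>\<pi>\<^sub>0\<close>.\<close>
  have "P 0 (\<lambda>_ _. 0, \<lambda>F. F)"
    using \<pi> by (simp add: P_def coefficient_families_def fps_algebra_morphism_def fps_linear_id
        intertwining_error_def fps_poisson_bracketD(5))
  moreover have "\<exists>y. P (Suc n) y \<and> Q n x y" if "P n x" for n x
  proof (cases x)
    case (Pair a \<Phi>)
    with that have *: "a \<in> coefficient_families K" "fps_algebra_morphism \<Phi>"
      "\<And>F G i. i < Suc n \<Longrightarrow> fps_nth (intertwining_error \<pi> (deformation a) \<Phi> F G) i = 0"
      by (auto simp: P_def)
    obtain a' \<Phi>' where "a' \<in> coefficient_families K" "fps_algebra_morphism \<Phi>'"
      "\<And>m. m < Suc n \<Longrightarrow> a' m = a m" "\<And>F i. i < Suc n \<Longrightarrow> fps_nth (\<Phi>' F) i = fps_nth (\<Phi> F) i"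
      "\<And>F G i. i < Suc (Suc n) \<Longrightarrow> fps_nth (intertwining_error \<pi> (deformation a') \<Phi>' F G) i = 0"
      by (rule extend_equivalence [OF \<pi> *(1,2) _ *(3)]) auto
    then have "P (Suc n) (a', \<Phi>') \<and> Q n x (a', \<Phi>')"
      by (auto simp: P_def Q_def Pair)
    then show ?thesis ..
  qed
  ultimately obtain x where x: "\<And>n. P n (x n)" "\<And>n. Q n (x n) (x (Suc n))"
    using dependent_nat_choice [of P Q] by blast
  define a where "a n = fst (x n)" for n
  define \<Phi> where "\<Phi> n = snd (x n)" for n
  have a: "a n \<in> coefficient_families K" and \<Phi>: "fps_algebra_morphism (\<Phi> n)"
    and low: "i \<le> n \<Longrightarrow> fps_nth (\<Phi> n (\<pi> [F, G])) i = fps_nth (deformation (a n) [\<Phi> n F, \<Phi> n G]) i"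
    for n i F G
    using x(1) [of n] by (auto simp: P_def a_def \<Phi>_def split_beta intertwining_error_def less_Suc_eq_le)
  have step: "a (Suc n) m = a n m" "fps_nth (\<Phi> (Suc n) F) m = fps_nth (\<Phi> n F) m" if "m \<le> n" for n m F
    using x(2) [of n] that by (auto simp: Q_def a_def \<Phi>_def split_beta)
  have stable: "a n m = a m m" "fps_nth (\<Phi> n F) m = fps_nth (\<Phi> m F) m" if "m \<le> n" for n m F
    using that by (induction n rule: dec_induct) (simp_all add: step)
  define b where "b m = a m m" for m
  define \<Omega> where "\<Omega> F = Abs_fps (\<lambda>m. fps_nth (\<Phi> m F) m)" for F
  have b: "b \<in> coefficient_families K"
    using a by (simp add: coefficient_families_def b_def)
  have \<Omega>_nth: "fps_nth (\<Omega> F) m = fps_nth (\<Phi> n F) m" if "m \<le> n" for F m n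
    using stable(2) [OF that] by (simp add: \<Omega>_def)
  note \<Phi>D = fps_algebra_morphismD [OF \<Phi>]
  have "fps_algebra_morphism \<Omega>"
    unfolding fps_algebra_morphism_def fps_linear_iff
  proof (intro conjI allI fps_ext)
    fix F G :: "'a fps" and c :: "'f fps" and n
    show "fps_nth (\<Omega> (F + G)) n = fps_nth (\<Omega> F + \<Omega> G) n"
      by (simp add: \<Omega>_nth [of n n] fps_linearD [OF \<Phi>D(1)])
    show "fps_nth (\<Omega> (fscale c F)) n = fps_nth (fscale c (\<Omega> F)) n"
      by (simp add: \<Omega>_nth [of _ n] fps_linearD [OF \<Phi>D(1)] fscale_nth)
    show "fps_nth (\<Omega> (F * G)) n = fps_nth (\<Omega> F * \<Omega> G) n"
      by (simp add: \<Omega>_nth [of _ n] \<Phi>D(2) fps_mult_nth)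
    show "fps_nth (\<Omega> F) 0 = fps_nth F 0"
      by (simp add: \<Omega>_nth [of 0 0] \<Phi>D(3))
  qed
  moreover have "\<Omega> (\<pi> [F, G]) = deformation b [\<Omega> F, \<Omega> G]" for F G
  proof (rule fps_ext)
    fix n
    have "fps_nth (\<Omega> (\<pi> [F, G])) n = fps_nth (deformation (a n) [\<Phi> n F, \<Phi> n G]) n"
      by (simp add: \<Omega>_nth [of n n] low)
    \<comment> \<open>The families \<open>a n\<close> and \<open>b\<close> agree for all indices up
      to \<open>n\<close>, hence their brackets agree through order \<open>n\<close>.\<close>
    also have "\<dots> = fps_nth (deformation b [\<Phi> n F, \<Phi> n G]) n"
      by (rule deformation_nth_cong [OF a b, of "Suc n"]) (auto simp: b_def less_Suc_eq_le intro: stable(1))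
    also have "\<dots> = fps_nth (deformation b [\<Omega> F, \<Omega> G]) n"
      by (rule fps_bilinear_nth_cong [OF fps_poisson_bracketD(1) [OF bracket_deformation [OF b]], of "Suc n"])
        (simp_all add: \<Omega>_nth [of _ n] less_Suc_eq_le)
    finally show "fps_nth (\<Omega> (\<pi> [F, G])) n = fps_nth (deformation b [\<Omega> F, \<Omega> G]) n" .
  qed
  ultimately show ?thesis
    using b by (auto simp: equivalent_deformations_iff)
qed

section \<open>Uniqueness of the parameters when the first cohomology vanishes\<close>

text \<open>At order \<open>n\<close> the difference of the morphisms depends on constant terms
  alone. Comparing both intertwining identities there makes the combination with coefficients
  \<open>a n k - b n k\<close> a coboundary, and independence of the basis classes does the
  rest.\<close>

lemma intertwiners_differ_by_coboundary:
  assumes \<pi>: "fps_poisson_bracket \<pi>\<^sub>0 \<pi>" and a: "a \<in> coefficient_families K" and b: "b \<in> coefficient_families K"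
    and \<Phi>: "fps_algebra_morphism \<Phi>" "\<And>F G. \<Phi> (\<pi> [F, G]) = deformation a [\<Phi> F, \<Phi> G]"
    and \<Omega>: "fps_algebra_morphism \<Omega>" "\<And>F G. \<Omega> (\<pi> [F, G]) = deformation b [\<Omega> F, \<Omega> G]"
    and n: "1 \<le> n" and agree: "\<And>m. m < n \<Longrightarrow> a m = b m"
    and low: "\<And>F i. i < n \<Longrightarrow> fps_nth (\<Phi> F) i = fps_nth (\<Omega> F) i"
  obtains V where "a n = b n" "V \<in> poisson_cocycles scale \<pi>\<^sub>0 1"
    "\<And>F. fps_nth (\<Phi> F) n = fps_nth (\<Omega> F) n + V [fps_nth F 0]"
proof -
  note \<Phi>D = fps_algebra_morphismD [OF \<Phi>(1)] and \<Omega>D = fps_algebra_morphismD [OF \<Omega>(1)]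
  define L where "L F = \<Phi> F - \<Omega> F" for F
  have L: "fps_linear L"
    unfolding L_def by (rule fps_linear_diff [OF \<Phi>D(1) \<Omega>D(1)])
  have L_low: "fps_nth (L F) i = 0" if "i < n" for F i
    using low [OF that] by (simp add: L_def)
  define v where "v x = fps_nth (L (fps_const x)) n" for x
  define V where "V Fs = (if length Fs = 1 then v (hd Fs) else 0)" for Fs
  have L_nth: "fps_nth (L F) n = v (fps_nth F 0)" for F
    unfolding v_def by (rule fps_linear_nth_const [OF L L_low])
  have V: "V \<in> multiderivations scale 1"
    unfolding V_def
  proof (rule multiderivations_1I)
    fix x y :: 'a and c :: 'f
    show "v (x + y) = v x + v y"
      by (simp add: v_def fps_linearD [OF L] flip: fps_const_add)
    show "v (scale c x) = scale c (v x)"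
      by (simp add: v_def fps_const_scale fps_linearD [OF L])
    \<comment> \<open>Telescoping a difference of products; at order \<open>n\<close> both \<Phi>
      and \<Omega> act on the outer factors as the identity.\<close>
    have "L (F * G) = \<Phi> F * L G + L F * \<Omega> G" for F G
      by (simp add: L_def \<Phi>D(2) \<Omega>D(2) algebra_simps)
    then show "v (x * y) = x * v y + y * v x"
      using L_low by (simp add: v_def fps_times_nth_lead \<Phi>D(3) \<Omega>D(3) mult.commute flip: fps_const_mult)
  qed
  \<comment> \<open>Outside the union of the supports both coefficients are 0, so the comparison
    over this finite set settles all indices.\<close>
  let ?A = "{k \<in> K. a n k \<noteq> 0} \<union> {k \<in> K. b n k \<noteq> 0}"
  have A: "finite ?A" "?A \<subseteq> K"
    using coefficient_families_support_finite [OF a] coefficient_families_support_finite [OF b] by auto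
  have v_eq: "v (\<pi>\<^sub>0 [f, g]) = \<pi>\<^sub>0 [v f, g] + \<pi>\<^sub>0 [f, v g] + (\<Sum>k\<in>?A. scale (a n k - b n k) (\<theta> k [f, g]))" for f g
  proof -
    let ?f = "fps_const f" and ?g = "fps_const g"
    have "v (\<pi>\<^sub>0 [f, g]) = fps_nth (deformation a [\<Phi> ?f, \<Phi> ?g]) n - fps_nth (deformation b [\<Omega> ?f, \<Omega> ?g]) n"
      using L_nth [of "\<pi> [?f, ?g]"] by (simp add: L_def \<Phi>(2) \<Omega>(2) fps_poisson_bracketD(5) [OF \<pi>])
    \<comment> \<open>First the morphism is exchanged under a fixed bracket, then the bracket under
      a fixed morphism.\<close>
    also have "fps_nth (deformation a [\<Phi> ?f, \<Phi> ?g]) n = fps_nth (deformation a [\<Omega> ?f, \<Omega> ?g]) n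
        + \<pi>\<^sub>0 [v f, g] + \<pi>\<^sub>0 [f, v g]"
      using fps_bracket_perturbation [OF bracket_deformation [OF a], of n "\<Phi> ?f" "\<Omega> ?f" "\<Phi> ?g" "\<Omega> ?g"] low
      by (simp add: v_def L_def \<Phi>D(3) \<Omega>D(3))
    also have "fps_nth (deformation a [\<Omega> ?f, \<Omega> ?g]) n = fps_nth (deformation b [\<Omega> ?f, \<Omega> ?g]) n
        + (\<Sum>k\<in>?A. scale (a n k - b n k) (\<theta> k [fps_nth (\<Omega> ?f) 0, fps_nth (\<Omega> ?g) 0]))"
      by (rule deformation_nth_diff [OF a b agree n A]) auto
    finally show ?thesis by (simp add: \<Omega>D(3))
  qed
  have \<delta>V: "poisson_delta scale \<pi>\<^sub>0 1 V Fs = - (\<Sum>k\<in>?A. scale (a n k - b n k) (\<theta> k Fs))" for Fs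
  proof (cases "length Fs = 2")
    case True
    then obtain f g where "Fs = [f, g]"
      by (auto simp: length_Suc_conv numeral_2_eq_2)
    then show ?thesis
      using v_eq [of f g] multiderivations_2D(6) [OF \<pi>\<^sub>0, of f "v g"]
      by (simp add: poisson_delta_1 [simplified] V_def)
  next
    \<comment> \<open>Equality of cochains is equality on all lists, so lists of other lengths need
      a check as well.\<close>
    case False
    then have "\<theta> k Fs = 0" if "k \<in> ?A" for k
      using that \<theta>_multiderivation multiderivations_eq_0 by blast
    with False show ?thesis
      by (simp add: poisson_delta_length)
  qed
  have "(\<lambda>Fs. - poisson_delta scale \<pi>\<^sub>0 1 V Fs) \<in> poisson_coboundaries scale \<pi>\<^sub>0 2"
    using V by (intro pointwise_subspaceD(4) [OF pointwise_subspace_coboundaries [OF \<pi>\<^sub>0]])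
      (auto simp: poisson_coboundaries_def)
  then have "(\<lambda>Fs. \<Sum>k\<in>?A. scale (a n k - b n k) (\<theta> k Fs)) \<in> poisson_coboundaries scale \<pi>\<^sub>0 2"
    by (simp only: \<delta>V minus_minus)
  from basis_family_independent [OF \<pi>\<^sub>0 basis \<theta> A this]
  have "a n k = b n k" if "k \<in> ?A" for k
    using that by simp
  moreover have "a n k = b n k" if "k \<notin> ?A" for k
    using that coefficient_families_eq_0 [OF a, of n k] coefficient_families_eq_0 [OF b, of n k]
    by (cases "k \<in> K") auto
  ultimately have ab: "a n = b n"
    by (intro ext) blast
  moreover have "V \<in> poisson_cocycles scale \<pi>\<^sub>0 1"
    using V \<delta>V by (simp add: poisson_cocycles_def ab fun_eq_iff)
  ultimately show thesis
    using that L_nth by (simp add: V_def L_def algebra_simps)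
qed

text \<open>The induction keeps \<Omega> fixed and replaces \<Phi> by another morphism intertwining
  \<open>\<pi>\<close> with \<open>deformation a\<close> that agrees with \<Omega> one order
  further.\<close>

lemma unique_equivalent:
  assumes H1: "carrier (poisson_cohomology scale \<pi>\<^sub>0 1) = {\<zero>\<^bsub>poisson_cohomology scale \<pi>\<^sub>0 1\<^esub>}"
    and \<pi>: "fps_poisson_bracket \<pi>\<^sub>0 \<pi>"
    and a: "a \<in> coefficient_families K" "equivalent_deformations scale \<pi> (deformation a)"
    and b: "b \<in> coefficient_families K" "equivalent_deformations scale \<pi> (deformation b)"
  shows "a = b"
proof -
  note Ba = fps_poisson_bracketD [OF bracket_deformation [OF a(1)]]
  obtain \<Omega> where \<Omega>: "fps_algebra_morphism \<Omega>" "\<And>F G. \<Omega> (\<pi> [F, G]) = deformation b [\<Omega> F, \<Omega> G]"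
    using b(2) by (auto simp: equivalent_deformations_iff)
  have "(\<forall>m\<le>n. a m = b m) \<and> (\<exists>\<Phi>. fps_algebra_morphism \<Phi> \<and>
      (\<forall>F G. \<Phi> (\<pi> [F, G]) = deformation a [\<Phi> F, \<Phi> G]) \<and>
      (\<forall>F. \<forall>i\<le>n. fps_nth (\<Phi> F) i = fps_nth (\<Omega> F) i))" for n
  proof (induction n)
    case 0
    \<comment> \<open>Index 0 carries no parameter: both families have the default value 0 there.
      The morphisms agree at order 0, being the identity modulo \<nu>.\<close>
    have "a 0 = b 0"
      using coefficient_families_eq_0 [OF a(1)] coefficient_families_eq_0 [OF b(1)] by auto
    with a(2) \<Omega>(1) show ?case
      by (auto simp: equivalent_deformations_iff fps_algebra_morphism_def)
  next
    case (Suc n)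
    then obtain \<Phi> where \<Phi>: "fps_algebra_morphism \<Phi>" "\<And>F G. \<Phi> (\<pi> [F, G]) = deformation a [\<Phi> F, \<Phi> G]"
      and low: "\<And>F i. i < Suc n \<Longrightarrow> fps_nth (\<Phi> F) i = fps_nth (\<Omega> F) i"
      and agree: "\<And>m. m < Suc n \<Longrightarrow> a m = b m"
      by (auto simp: less_Suc_eq_le)
    obtain V where ab: "a (Suc n) = b (Suc n)" and V: "V \<in> poisson_cocycles scale \<pi>\<^sub>0 1"
      and V_nth: "\<And>F. fps_nth (\<Phi> F) (Suc n) = fps_nth (\<Omega> F) (Suc n) + V [fps_nth F 0]"
      by (rule intertwiners_differ_by_coboundary [OF \<pi> a(1) b(1) \<Phi> \<Omega> _ agree low]) auto
    from trivial_cohomologyD [OF \<pi>\<^sub>0 H1 V] obtain h where "V = poisson_delta scale \<pi>\<^sub>0 0 h"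
      by (auto simp: poisson_coboundaries_def)
    then have V_eq: "V [x] = - \<pi>\<^sub>0 [h [], x]" for x
      by (simp add: poisson_delta_0)
    \<comment> \<open>The Hamiltonian derivation is taken for the full bracket
      \<open>deformation a\<close>, so that its exponential respects that bracket; modulo \<nu> it
      is still \<open>\<pi>\<^sub>0 [h [], _]\<close>.\<close>
    define L where "L F = deformation a [fps_const (h []), F]" for F
    define D where "D F = fscale (fps_X ^ Suc n) (L F)" for F
    have L: "fps_linear L"
      unfolding L_def by (rule fps_bilinearD(2) [OF Ba(1)])
    have skew: "deformation a [F, G] = - deformation a [G, F]" for F G
      by (rule Ba(2))
    have L_mult: "L (F * G) = L F * G + F * L G" for F G
      using skew [of "fps_const (h [])" "F * G"] skew [of "fps_const (h [])" F] skew [of "fps_const (h [])" G]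
      by (simp add: L_def Ba(3) algebra_simps)
    \<comment> \<open>The Jacobi identity, read as a derivation property of the bracket with a fixed
      element.\<close>
    have L_bracket: "L (deformation a [F, G]) = deformation a [L F, G] + deformation a [F, L G]" for F G
      using Ba(4) [of "fps_const (h [])" F G] skew [of "fps_const (h [])" "deformation a [F, G]"]
        skew [of F "L G"] skew [of G "fps_const (h [])"]
      by (simp add: L_def fps_bilinear_left [OF Ba(1)] algebra_simps)
    have D: "fps_linear D" "\<And>F. fps_nth (D F) 0 = 0"
      unfolding D_def using L by (simp_all add: fps_linear_fscale del: power_Suc)
    have "D (deformation a [F, G]) = deformation a [D F, G] + deformation a [F, D G]" for F G
      by (simp add: D_def L_bracket fps.scale_right_distrib fps_bilinear_left [OF Ba(1)]
          fps_bilinear_right [OF Ba(1)])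
    note exp_bracket = fps_exp_map_bilinear [OF D Ba(1) this]
    define \<Phi>' where "\<Phi>' F = fps_exp_map D (\<Phi> F)" for F
    have "fps_algebra_morphism \<Phi>'"
      unfolding \<Phi>'_def D_def by (rule fps_algebra_morphism_exp_comp [OF \<Phi>(1) L L_mult]) simp
    moreover have "\<Phi>' (\<pi> [F, G]) = deformation a [\<Phi>' F, \<Phi>' G]" for F G
      by (simp add: \<Phi>'_def \<Phi>(2) exp_bracket)
    moreover have "fps_nth (\<Phi>' F) i = fps_nth (\<Omega> F) i" if "i \<le> Suc n" for F i
    proof -
      \<comment> \<open>The term added at order \<open>Suc n\<close> is
        \<open>- V [fps_nth F 0]\<close>, which cancels the remaining difference from
        \<Omega>.\<close>
      have "fps_nth (\<Phi>' F) i = fps_nth (\<Phi> F) i + (if i = Suc n then \<pi>\<^sub>0 [h [], fps_nth F 0] else 0)"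
        using fps_exp_map_X_power_nth [OF L _ that]
        by (simp add: \<Phi>'_def D_def [abs_def] L_def Ba(5) fps_algebra_morphismD(3) [OF \<Phi>(1)] del: power_Suc)
      then show ?thesis
        using that low [of i F] V_nth [of F] V_eq by (cases "i = Suc n") auto
    qed
    ultimately show ?case
      using agree ab by (auto simp: le_Suc_eq less_Suc_eq_le)
  qed
  then show ?thesis by (intro ext) (metis order_refl)
qed

end

theorem proposition1p1:
  fixes scale :: "'f::field_char_0 \<Rightarrow> 'a::comm_ring \<Rightarrow> 'a"
    and \<pi>\<^sub>0 :: "'a list \<Rightarrow> 'a"
    and K :: "'k set"
    and \<theta> :: "'k \<Rightarrow> 'a list \<Rightarrow> 'a"
    and \<Psi> :: "(nat \<Rightarrow> 'k \<Rightarrow> 'f) \<Rightarrow> nat \<Rightarrow> 'a list \<Rightarrow> 'a"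
  assumes "comm_algebra scale"
    and "poisson_structure scale \<pi>\<^sub>0"
    and "\<forall>k\<in>K. \<theta> k \<in> poisson_cocycles scale \<pi>\<^sub>0 2"
    and "basis_family (poisson_cohomology scale \<pi>\<^sub>0 2) K (\<lambda>k. cohomology_class scale \<pi>\<^sub>0 2 (\<theta> k))"
    and "\<forall>a\<in>coefficient_families K. \<forall>n\<ge>1. \<Psi> a n \<in> multiderivations scale 2"
    and "\<forall>a\<in>coefficient_families K. \<Psi> a 1 = (\<lambda>_. 0)"
    and "\<forall>n\<ge>1. \<forall>a\<in>coefficient_families K. \<forall>b\<in>coefficient_families K.
           (\<forall>k\<in>K. \<forall>m. 1 \<le> m \<and> m \<le> n - 1 \<longrightarrow> a m k = b m k) \<longrightarrow> \<Psi> a n = \<Psi> b n"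
    and "\<forall>a\<in>coefficient_families K.
           formal_deformation scale \<pi>\<^sub>0 (deformation_family scale \<pi>\<^sub>0 K \<theta> (\<Psi> a) a)"
  shows "(\<forall>\<pi>. formal_deformation scale \<pi>\<^sub>0 \<pi> \<longrightarrow>
            (\<exists>a\<in>coefficient_families K.
               equivalent_deformations scale \<pi> (deformation_family scale \<pi>\<^sub>0 K \<theta> (\<Psi> a) a))) \<and>
         (carrier (poisson_cohomology scale \<pi>\<^sub>0 1) = {\<zero>\<^bsub>poisson_cohomology scale \<pi>\<^sub>0 1\<^esub>} \<longrightarrow>
            (\<forall>\<pi>. formal_deformation scale \<pi>\<^sub>0 \<pi> \<longrightarrow>
               (\<exists>!a. a \<in> coefficient_families K \<and>
                  equivalent_deformations scale \<pi> (deformation_family scale \<pi>\<^sub>0 K \<theta> (\<Psi> a) a))))"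
proof -
  interpret comm_algebra scale by fact
  interpret poisson_deformation_family scale \<pi>\<^sub>0 K \<theta> \<Psi>
  proof
    show "\<pi>\<^sub>0 \<in> multiderivations scale 2"
      using assms(2) by (simp add: poisson_structure_def)
    show "\<Psi> a n = \<Psi> b n"
      if "1 \<le> n" "a \<in> coefficient_families K" "b \<in> coefficient_families K"
        "\<And>k m. k \<in> K \<Longrightarrow> 1 \<le> m \<Longrightarrow> m \<le> n - 1 \<Longrightarrow> a m k = b m k" for a b n
      by (rule assms(7) [rule_format]) (use that in simp_all)
  qed (use assms(3,4,5,8) in blast)+
  show ?thesis
  \<comment> \<open>Unique existence splits into existence, which repeats the first claim, and
    uniqueness, where the cohomology assumption enters.\<close>
  proof (intro conjI allI impI ex_ex1I)
    fix \<pi> assume "formal_deformation scale \<pi>\<^sub>0 \<pi>"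
    then have \<pi>: "fps_poisson_bracket \<pi>\<^sub>0 \<pi>"
      by (rule formal_deformation_imp_bracket)
    show ex: "\<exists>a\<in>coefficient_families K. equivalent_deformations scale \<pi> (deformation a)"
      by (rule exists_equivalent [OF \<pi>])
    then show "\<exists>a. a \<in> coefficient_families K \<and> equivalent_deformations scale \<pi> (deformation a)"
      by (simp only: Bex_def)
    assume H1: "carrier (poisson_cohomology scale \<pi>\<^sub>0 1) = {\<zero>\<^bsub>poisson_cohomology scale \<pi>\<^sub>0 1\<^esub>}"
    show "a = b"
      if "a \<in> coefficient_families K \<and> equivalent_deformations scale \<pi> (deformation a)"
        "b \<in> coefficient_families K \<and> equivalent_deformations scale \<pi> (deformation b)" for a b
      using that by (intro unique_equivalent [OF H1 \<pi>]) simp_all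
  qed
qed

end
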